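(* Let $k \geq 3$ and let $K$ be a $k$-partite $k$-graph on $b$ vertices. Then for any $\alpha > 0$ there exists $n_0$ such that if $G$ is a $k$-graph on $n \geq n_0$ vertices for which $b$ divides $n$ and $\delta(G) \geq n/2 + \alpha n$, then $G$ contains a perfect $K$-packing.
   Context: A $k$-graph ($k$-uniform hypergraph) consists of a finite vertex set and a set of edges, each edge being a set of exactly $k$ vertices. The minimum codegree $\delta(G)$ of a $k$-graph $G$ is the minimum, over all sets $S$ of $k-1$ vertices of $G$, of the number of edges of $G$ containing $S$. A $K$-packing in $G$ is a collection of vertex-disjoint copies of $K$ in $G$ (copies as not necessarily induced subgraphs); it is perfect if it covers every vertex of $G$. A $k$-partite realisation of a $k$-graph $K$ with at least one edge is a partition of $V(K)$ into vertex classes $U_1,\dots,U_k$ such that $|e \cap U_j| = 1$ for every edge $e$ of $K$ and every $1 \leq j \leq k$; $K$ is $k$-partite if it has at least one edge and admits a $k$-partite realisation. *)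

theory Defs
  imports Complex_Main "HOL-Library.Disjoint_Sets"
begin

record 'a hypergraph =
  verts :: "'a set"
  edges :: "'a set set"

definition kgraph :: "nat \<Rightarrow> 'a hypergraph \<Rightarrow> bool" where
  "kgraph k G \<longleftrightarrow> finite (verts G) \<and> (\<forall>e\<in>edges G. e \<subseteq> verts G \<and> card e = k)"

definition codegree :: "'a hypergraph \<Rightarrow> 'a set \<Rightarrow> nat" where
  "codegree G S = card {e \<in> edges G. S \<subseteq> e}"

text \<open>The value is only meaningful if the hypergraph has at least k - 1 vertices; otherwise
  the minimum is over the empty set.\<close>
definition min_codegree :: "nat \<Rightarrow> 'a hypergraph \<Rightarrow> nat" where
  "min_codegree k G = Min (codegree G ` {S. S \<subseteq> verts G \<and> card S = k - 1})"

definition partite_realisation :: "nat \<Rightarrow> 'a hypergraph \<Rightarrow> (nat \<Rightarrow> 'a set) \<Rightarrow> bool" where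
  "partite_realisation k K U \<longleftrightarrow>
     disjoint_family_on U {1..k} \<and> (\<Union>j\<in>{1..k}. U j) = verts K \<and>
     (\<forall>e\<in>edges K. \<forall>j\<in>{1..k}. card (e \<inter> U j) = 1)"

definition kpartite :: "nat \<Rightarrow> 'a hypergraph \<Rightarrow> bool" where
  "kpartite k K \<longleftrightarrow> edges K \<noteq> {} \<and> (\<exists>U. partite_realisation k K U)"

definition hypergraph_iso :: "'a hypergraph \<Rightarrow> 'b hypergraph \<Rightarrow> bool" where
  "hypergraph_iso K H \<longleftrightarrow>
     (\<exists>f. bij_betw f (verts K) (verts H) \<and> edges H = (\<lambda>e. f ` e) ` edges K)"

definition subhypergraph :: "'a hypergraph \<Rightarrow> 'a hypergraph \<Rightarrow> bool" where
  "subhypergraph H G \<longleftrightarrow> verts H \<subseteq> verts G \<and> edges H \<subseteq> edges G"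

definition is_copy :: "'a hypergraph \<Rightarrow> 'b hypergraph \<Rightarrow> 'b hypergraph \<Rightarrow> bool" where
  "is_copy K G H \<longleftrightarrow> subhypergraph H G \<and> hypergraph_iso K H"

definition packing :: "'a hypergraph \<Rightarrow> 'b hypergraph \<Rightarrow> 'b hypergraph set \<Rightarrow> bool" where
  "packing K G P \<longleftrightarrow>
     (\<forall>H\<in>P. is_copy K G H) \<and> pairwise (\<lambda>H H'. disjnt (verts H) (verts H')) P"

definition perfect_packing :: "'a hypergraph \<Rightarrow> 'b hypergraph \<Rightarrow> 'b hypergraph set \<Rightarrow> bool" where
  "perfect_packing K G P \<longleftrightarrow> packing K G P \<and> (\<Union>H\<in>P. verts H) = verts G"

end

theory Submission
  imports Defs
begin

text \<open>
  The proof uses the absorbing method. Only the edge set E and vertex sets matter: a set is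
  called tiled if it is a disjoint union of vertex sets of copies of K, and the goal is to
  tile the whole vertex set V.

  Since K is k-partite with b vertices, it lies in the complete k-partite k-graph with b
  vertices in each class, and k copies of K, obtained by rotating the classes cyclically,
  tile that graph (\<open>balanced_clique_tiled_by_copies\<close>). So K may mostly be
  replaced by balanced complete k-partite k-graphs, called balanced cliques below. These are
  found by counting: a k-ary relation of density d contains a blow-up with class sizes t_1,
  ..., t_k at least in the proportion d^(t_1 * ... * t_k) that holds for random relations
  (\<open>count_blowups\<close>, by convexity), so dense relations contain a positive
  proportion of all possible blow-ups.

  Almost perfect tiling (\<open>almost_perfect_tiling\<close>). Suppose cliques with class
  size T = 2(k-1)t cover a fraction c of V, and let L be the uncovered part. If L has
  positive edge density, it contains a clique of class size t, which can be added. Otherwise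
  the (k-1)-tuples in L are joined, on average, to more than half of the covered vertices,
  hence to more than half of the vertices of some clique B of the tiling. By pigeonhole a
  dense set of (k-1)-tuples of L is joined completely to one set W of at least half the
  vertices of B. As k is at least 3, W has at least t vertices in each of two classes of B.
  Pick t of them in each; each of these two t-sets forms a clique with (k-1)t vertices of L,
  and what is left of B, after cutting the other classes to the same size, is a clique of
  class size T - t. This exchange (\<open>exchange\<close>) gains kt vertices, that is the
  proportion 1/(2(k-1)+1) of the newly tiled ones. Repeating it raises the covered fraction
  by a constant that depends only on k and \<open>\<alpha>\<close>, not on t; so boundedly
  many rounds, each with a smaller class size, cover nearly everything.

  Absorption (\<open>absorbing_set\<close>). For any two vertices x and y the codegree
  condition makes the common link of x and y dense. So there are many tuples S for which
  both S with x and S with y span balanced cliques of class size b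
  (\<open>many_connectors\<close>). For a b-set Q = {q_1, ..., q_b} combine a copy {p_1,
  ..., p_b} of K with such an S_i for each pair q_i, p_i: the set A = {p_1, ..., p_b}
  \<open>\<union>\<close> S_1 \<open>\<union>\<close> ... \<open>\<union>\<close> S_b is
  tiled, and so is A \<open>\<union>\<close> Q, because each S_i can be completed with q_i
  instead of p_i. A positive proportion of tuples are such absorbers
  (\<open>many_absorbers\<close>). A small disjoint family with linearly many absorbers for
  every Q is then chosen greedily, so as to decrease the potential that sums 2^(-number of
  absorbers of Q) over all Q (\<open>greedy_disjoint_family\<close>); this derandomises the
  usual random choice of absorbers.

  To finish, set aside the union A of the absorbing family, tile almost all of V - A with
  balanced cliques, and absorb the leftover, whose size is divisible by b, into A.
\<close>

section \<open>Counting tuples\<close>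

definition tuples :: "nat \<Rightarrow> 'v set \<Rightarrow> 'v list set" where
  "tuples m V = {xs. set xs \<subseteq> V \<and> length xs = m}"

lemma finite_tuples [simp]: "finite V \<Longrightarrow> finite (tuples m V)"
  unfolding tuples_def by (rule finite_lists_length_eq)

lemma card_tuples: "finite V \<Longrightarrow> card (tuples m V) = card V ^ m"
  unfolding tuples_def by (rule card_lists_length_eq)

lemma tuples_0 [simp]: "tuples 0 V = {[]}"
  by (auto simp: tuples_def)

lemma tuples_Suc: "tuples (Suc m) V = (\<lambda>(x, xs). x # xs) ` (V \<times> tuples m V)"
  by (auto simp: tuples_def length_Suc_conv image_iff)

lemma sum_tuples_Suc:
  "(\<Sum>xs\<in>tuples (Suc m) V. f xs) = (\<Sum>x\<in>V. \<Sum>xs\<in>tuples m V. f (x # xs))"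
  by (simp add: tuples_Suc sum.reindex inj_on_def sum.cartesian_product case_prod_unfold)

lemma real_card_filter:
  "finite A \<Longrightarrow> real (card {x\<in>A. P x}) = (\<Sum>x\<in>A. if P x then 1 else 0)"
  by (simp add: sum.If_cases Int_def)

lemma card_tuples_Suc:
  assumes "finite V"
  shows "real (card {xs\<in>tuples (Suc m) V. P xs})
    = (\<Sum>xs\<in>tuples m V. real (card {x\<in>V. P (x # xs)}))"
proof -
  have "real (card {xs\<in>tuples (Suc m) V. P xs})
    = (\<Sum>x\<in>V. \<Sum>xs\<in>tuples m V. if P (x # xs) then 1 else 0)"
    using assms by (simp add: real_card_filter sum_tuples_Suc)
  also have "\<dots> = (\<Sum>xs\<in>tuples m V. \<Sum>x\<in>V. if P (x # xs) then 1 else 0)"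
    by (rule sum.swap)
  finally show ?thesis
    using assms by (simp add: real_card_filter)
qed

text \<open>Only a fraction O(1/|V|) of all tuples repeat an entry, and a fraction at most m |F| / |V|
  meet F. The bound is Bernoulli's inequality applied to ((|V| - |F| - m) / |V|)^m; it is
  trivial when |F| + m exceeds |V|.\<close>

lemma card_clean_tuples:
  assumes "finite V" "F \<subseteq> V"
  shows "real (card {xs\<in>tuples m V. distinct xs \<and> set xs \<inter> F = {}})
    \<ge> (1 - m * (card F + m) / card V) * real (card V) ^ m"
proof (cases "card F + m \<le> card V \<and> m > 0")
  case False
  show ?thesis
  proof (cases "m = 0")
    case True
    have "{xs\<in>tuples m V. distinct xs \<and> set xs \<inter> F = {}} = {[]}"
      using True by auto
    then show ?thesis using True by simp
  next
    case m: False
    with False have "card F + m > card V" by simp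
    moreover have "real (card F + m) \<le> real m * real (card F + m)"
      using m by (simp add: mult_le_cancel_right1)
    ultimately have "real m * real (card F + m) \<ge> real (card V)"
      by linarith
    then have le: "real (card V) \<le> real (m * (card F + m))" by simp
    show ?thesis
    proof (cases "card V = 0")
      case True
      then show ?thesis using m by (simp add: power_0_left)
    next
      case False
      then have "1 \<le> real (m * (card F + m)) / real (card V)"
        using le by (subst le_divide_eq_1_pos) simp_all
      then have "(1 - real (m * (card F + m)) / card V) * real (card V) ^ m \<le> 0"
        by (intro mult_nonpos_nonneg) simp_all
      then show ?thesis
        by (rule order_trans) simp
    qed
  qed
next
  case True
  let ?n = "card V"
  have fF: "finite F" using assms finite_subset by blast
  have cVF: "card (V - F) = ?n - card F"
    using assms fF by (simp add: card_Diff_subset)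
  have eq: "{xs\<in>tuples m V. distinct xs \<and> set xs \<inter> F = {}}
    = {xs. length xs = m \<and> distinct xs \<and> set xs \<subseteq> V - F}"
    by (auto simp: tuples_def)
  have "card {xs\<in>tuples m V. distinct xs \<and> set xs \<inter> F = {}}
    = \<Prod>{?n - card F - m + 1..?n - card F}"
    unfolding eq using assms True cVF
    by (subst card_lists_distinct_length_eq) auto
  moreover have "(\<Prod>i\<in>{?n - card F - m + 1..?n - card F}. ?n - card F - m)
      \<le> \<Prod>{?n - card F - m + 1..?n - card F}"
    by (rule prod_mono) auto
  moreover have "card {?n - card F - m + 1..?n - card F} = m"
    using True by simp
  ultimately have "card {xs\<in>tuples m V. distinct xs \<and> set xs \<inter> F = {}} \<ge> (?n - card F - m) ^ m"
    by simp
  then have *: "real (card {xs\<in>tuples m V. distinct xs \<and> set xs \<inter> F = {}})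
      \<ge> real (?n - card F - m) ^ m"
    by (simp only: of_nat_power[symmetric] of_nat_le_iff)
  have n0: "?n > 0" using True by linarith
  have "1 + real m * (- (real (card F + m) / ?n)) \<le> (1 + (- (real (card F + m) / ?n))) ^ m"
    using True n0 by (intro Bernoulli_inequality) (simp add: field_simps)
  then have "(1 - m * (card F + m) / ?n) * real ?n ^ m \<le> (1 + (- (real (card F + m) / ?n))) ^ m * real ?n ^ m"
    by (intro mult_right_mono) auto
  also have "\<dots> = ((1 + (- (real (card F + m) / ?n))) * ?n) ^ m"
    by (simp only: power_mult_distrib)
  also have "(1 + (- (real (card F + m) / ?n))) * ?n = real (?n - card F - m)"
    using n0 True by (simp add: field_simps of_nat_diff)
  finally show ?thesis using * by linarith
qed

section \<open>The power mean inequality\<close>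

lemma power_tangent:
  fixes a x :: real
  assumes "a \<ge> 0" "x \<ge> 0"
  shows "a ^ m + m * a ^ (m - 1) * (x - a) \<le> x ^ m"
proof (induction m)
  case (Suc m)
  show ?case
  proof (cases "m = 0")
    case False
    then have am: "a ^ m = a * a ^ (m - 1)" by (cases m) auto
    have "x * (a ^ m + m * a ^ (m - 1) * (x - a)) \<le> x * x ^ m"
      using Suc assms by (intro mult_left_mono) auto
    moreover have "x * (a ^ m + m * a ^ (m - 1) * (x - a))
      - (a ^ Suc m + Suc m * a ^ m * (x - a)) = m * a ^ (m - 1) * (x - a)\<^sup>2"
      unfolding am by (simp add: algebra_simps power2_eq_square am)
    moreover have "m * a ^ (m - 1) * (x - a)\<^sup>2 \<ge> 0"
      using assms by simp
    ultimately show ?thesis by simp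
  qed auto
qed auto

text \<open>Summing the tangent inequality at the mean of f: the linear terms cancel.\<close>

lemma power_mean:
  fixes f :: "'b \<Rightarrow> real"
  assumes "finite A" "A \<noteq> {}" "\<And>x. x \<in> A \<Longrightarrow> f x \<ge> 0"
  shows "card A * (sum f A / card A) ^ m \<le> (\<Sum>x\<in>A. f x ^ m)"
proof -
  let ?a = "sum f A / card A"
  have "?a \<ge> 0" using assms by (simp add: sum_nonneg)
  have "card A * ?a ^ m = (\<Sum>x\<in>A. ?a ^ m + m * ?a ^ (m - 1) * (f x - ?a))"
    using assms by (simp add: sum.distrib sum_distrib_left[symmetric] sum_subtractf)
  also have "\<dots> \<le> (\<Sum>x\<in>A. f x ^ m)"
    using assms \<open>?a \<ge> 0\<close> by (intro sum_mono power_tangent) auto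
  finally show ?thesis .
qed

section \<open>Counting blow-ups of dense relations\<close>

lemma listset_iff_nth:
  "xs \<in> listset As \<longleftrightarrow> length xs = length As \<and> (\<forall>i<length As. xs ! i \<in> As ! i)"
proof (induction As arbitrary: xs)
  case (Cons A As)
  show ?case
    by (cases xs) (auto simp: set_Cons_def Cons nth_Cons less_Suc_eq_0_disj split: nat.splits)
qed auto

lemma Cons_in_listset: "x # xs \<in> listset (A # As) \<longleftrightarrow> x \<in> A \<and> xs \<in> listset As"
  by (auto simp: set_Cons_def)

text \<open>Candidates for a blow-up of a tuple: the i-th entry is replaced by a tuple of length ts ! i,
  which lists the i-th vertex class of a multipartite structure.\<close>

definition blowups :: "nat list \<Rightarrow> 'v set \<Rightarrow> 'v list list set" where
  "blowups ts V = listset (map (\<lambda>t. tuples t V) ts)"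

lemma blowups_Nil [simp]: "blowups [] V = {[]}"
  by (simp add: blowups_def)

lemma blowups_Cons: "blowups (t # ts) V = (\<lambda>(y, ys). y # ys) ` (tuples t V \<times> blowups ts V)"
  by (auto simp: blowups_def set_Cons_def image_iff)

lemma finite_blowups [simp]: "finite V \<Longrightarrow> finite (blowups ts V)"
  by (induction ts) (auto simp: blowups_Cons)

lemma blowups_lengths: "yss \<in> blowups ts V \<Longrightarrow> map length yss = ts"
  by (induction ts arbitrary: yss) (auto simp: blowups_Cons tuples_def)

lemma blowups_subset: "yss \<in> blowups ts V \<Longrightarrow> set (concat yss) \<subseteq> V"
proof (induction ts arbitrary: yss)
  case (Cons t ts)
  then obtain y ys where "yss = y # ys" "y \<in> tuples t V" "ys \<in> blowups ts V"
    by (auto simp: blowups_Cons)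
  with Cons.IH[of ys] show ?case by (simp add: tuples_def)
qed simp

lemma concat_blowups: "concat ` blowups ts V \<subseteq> tuples (sum_list ts) V"
  using blowups_lengths blowups_subset by (fastforce simp: tuples_def length_concat)

lemma inj_on_concat_blowups: "inj_on concat (blowups ts V)"
proof (rule inj_onI)
  fix xs ys assume *: "xs \<in> blowups ts V" "ys \<in> blowups ts V" "concat xs = concat ys"
  then have l: "map length xs = ts" "map length ys = ts"
    using blowups_lengths by blast+
  then have "length xs = length ys"
    by (metis length_map)
  moreover have "\<forall>(x, y)\<in>set (zip xs ys). length x = length y"
    using l by (auto simp: set_zip) (metis nth_map)
  ultimately show "xs = ys"
    using *(3) concat_injective by blast
qed

text \<open>Complete multipartite patterns occur at least as often as in a random relation of the same
  density. By induction on the number of classes: for a tuple ys listing the first class, let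
  D ys be the density of the relation of those xs for which y # xs satisfies P for all y in
  ys. The power mean inequality over the tails xs bounds the average of D from below by the
  t-th power of the density of P; the induction hypothesis applied to each ys and the power
  mean inequality over ys give the claim.\<close>

lemma count_blowups:
  assumes fin: "finite V" and ne: "V \<noteq> {}"
  shows "(card {xs\<in>tuples (length ts) V. P xs} / real (card V) ^ length ts) ^ prod_list ts
      * real (card V) ^ sum_list ts
    \<le> card {yss\<in>blowups ts V. \<forall>xs\<in>listset (map set yss). P xs}"
proof (induction ts arbitrary: P)
  case Nil
  have "{xs. xs = [] \<and> P xs} = (if P [] then {[]} else {})" by auto
  then show ?case by (auto simp: Collect_conv_if)
next
  case (Cons t ts)
  let ?n = "real (card V)" and ?k = "length ts" and ?m = "prod_list ts"
  have n: "?n > 0" using fin ne by (simp add: card_gt_0_iff)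
  define N where "N xs = real (card {x\<in>V. P (x # xs)})" for xs
  define Q where "Q ys xs \<longleftrightarrow> (\<forall>x\<in>set ys. P (x # xs))" for ys xs
  define D where "D ys = card {xs\<in>tuples ?k V. Q ys xs} / ?n ^ ?k" for ys
  have cT: "real (card (tuples j V)) = ?n ^ j" for j
    using fin by (simp add: card_tuples)
  have neT: "tuples j V \<noteq> {}" for j
  proof -
    have "real (card (tuples j V)) > 0" using n cT by simp
    then show ?thesis by fastforce
  qed
  define d where "d = card {xs\<in>tuples (Suc ?k) V. P xs} / ?n ^ Suc ?k"
  have N: "sum N (tuples ?k V) = d * ?n ^ Suc ?k"
    unfolding N_def d_def using fin n by (subst card_tuples_Suc) auto
  have "(\<Sum>ys\<in>tuples t V. D ys) * ?n ^ ?k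
      = (\<Sum>ys\<in>tuples t V. \<Sum>xs\<in>tuples ?k V. if Q ys xs then 1 else 0)"
    unfolding D_def sum_distrib_right using n fin ne by (simp add: real_card_filter)
  also have "\<dots> = (\<Sum>xs\<in>tuples ?k V. \<Sum>ys\<in>tuples t V. if Q ys xs then 1 else 0)"
    by (rule sum.swap)
  also have "\<dots> = (\<Sum>xs\<in>tuples ?k V. N xs ^ t)"
  proof (rule sum.cong[OF refl])
    fix xs
    have "{ys\<in>tuples t V. Q ys xs} = tuples t {x\<in>V. P (x # xs)}"
      by (auto simp: tuples_def Q_def)
    then show "(\<Sum>ys\<in>tuples t V. if Q ys xs then 1 else 0) = N xs ^ t"
      using fin by (simp add: real_card_filter[symmetric] card_tuples N_def)
  qed
  also have "\<dots> \<ge> ?n ^ ?k * (d * ?n ^ Suc ?k / ?n ^ ?k) ^ t"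
    using power_mean[of "tuples ?k V" N t] fin neT N cT by (simp add: N_def)
  finally have "?n ^ ?k * (d * ?n) ^ t \<le> (\<Sum>ys\<in>tuples t V. D ys) * ?n ^ ?k"
    using n by simp
  then have "(d * ?n) ^ t * ?n ^ ?k \<le> (\<Sum>ys\<in>tuples t V. D ys) * ?n ^ ?k"
    by (simp only: mult.commute)
  then have D: "d ^ t * ?n ^ t \<le> (\<Sum>ys\<in>tuples t V. D ys)"
    using n by (simp add: power_mult_distrib)
  have D0: "D ys \<ge> 0" for ys unfolding D_def by simp
  have "d \<ge> 0" unfolding d_def by simp
  then have "(d ^ t) ^ ?m \<le> ((\<Sum>ys\<in>tuples t V. D ys) / ?n ^ t) ^ ?m"
    using D n by (intro power_mono) (auto simp: field_simps)
  then have "?n ^ t * (d ^ t) ^ ?m \<le> ?n ^ t * ((\<Sum>ys\<in>tuples t V. D ys) / ?n ^ t) ^ ?m"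
    using n by (intro mult_left_mono) auto
  also have "\<dots> \<le> (\<Sum>ys\<in>tuples t V. D ys ^ ?m)"
    using power_mean[of "tuples t V" D ?m] fin neT cT D0 by simp
  finally have "?n ^ t * (d ^ t) ^ ?m * ?n ^ sum_list ts
      \<le> (\<Sum>ys\<in>tuples t V. D ys ^ ?m) * ?n ^ sum_list ts"
    using n by (intro mult_right_mono) auto
  also have "\<dots> \<le> (\<Sum>ys\<in>tuples t V. real (card {yss\<in>blowups ts V. \<forall>xs\<in>listset (map set yss). Q ys xs}))"
    unfolding sum_distrib_right
    using Cons.IH unfolding D_def by (intro sum_mono) auto
  also have "\<dots> = card (SIGMA ys:tuples t V. {yss\<in>blowups ts V. \<forall>xs\<in>listset (map set yss). Q ys xs})"
    using fin by (subst card_SigmaI) auto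
  also have "\<dots> = card ((\<lambda>(y, ys). y # ys) `
      (SIGMA ys:tuples t V. {yss\<in>blowups ts V. \<forall>xs\<in>listset (map set yss). Q ys xs}))"
    by (subst card_image) (auto simp: inj_on_def)
  also have "(\<lambda>(y, ys). y # ys) `
      (SIGMA ys:tuples t V. {yss\<in>blowups ts V. \<forall>xs\<in>listset (map set yss). Q ys xs})
    = {yss\<in>blowups (t # ts) V. \<forall>xs\<in>listset (map set yss). P xs}"
    by (auto simp: blowups_Cons image_iff Q_def set_Cons_def)
  finally show ?case
    using n by (simp add: power_mult[symmetric] power_add ac_simps d_def)
qed

text \<open>For large V the blow-ups with a repeated vertex are at most half of those counted by
  \<open>count_blowups\<close>, because flattening embeds them into the tuples of length
  sum_list ts with a repetition.\<close>

lemma many_distinct_blowups: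
  fixes d :: real
  assumes "d > 0"
  shows "\<exists>N. \<forall>V :: 'v set. \<forall>P. finite V \<longrightarrow> card V \<ge> N \<longrightarrow>
    card {xs\<in>tuples (length ts) V. P xs} \<ge> d * real (card V) ^ length ts \<longrightarrow>
    card {yss\<in>blowups ts V. distinct (concat yss) \<and> (\<forall>xs\<in>listset (map set yss). P xs)}
      \<ge> d ^ prod_list ts / 2 * real (card V) ^ sum_list ts"
proof -
  let ?m = "sum_list ts" and ?c = "d ^ prod_list ts"
  have c: "?c > 0" using assms by simp
  obtain N :: nat where N: "real N \<ge> 2 * (real ?m)\<^sup>2 / ?c + 1"
    using real_arch_simple by blast
  show ?thesis
  proof (intro exI allI impI)
    fix V :: "'v set" and P
    assume fin: "finite V" and NV: "card V \<ge> N"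
      and d: "card {xs\<in>tuples (length ts) V. P xs} \<ge> d * real (card V) ^ length ts"
    let ?n = "real (card V)"
    have nN: "?n \<ge> 2 * (real ?m)\<^sup>2 / ?c + 1" using N NV by linarith
    moreover have "2 * (real ?m)\<^sup>2 / ?c \<ge> 0" using c by simp
    ultimately have n: "?n > 0" by linarith
    let ?A = "{yss\<in>blowups ts V. \<forall>xs\<in>listset (map set yss). P xs}"
    let ?B = "{yss\<in>blowups ts V. \<not> distinct (concat yss)}"
    have "?c \<le> (card {xs\<in>tuples (length ts) V. P xs} / ?n ^ length ts) ^ prod_list ts"
      using d n assms by (intro power_mono) (auto simp: field_simps)
    then have "?c * ?n ^ ?m \<le>
        (card {xs\<in>tuples (length ts) V. P xs} / ?n ^ length ts) ^ prod_list ts * ?n ^ ?m"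
      using n by (intro mult_right_mono) auto
    also have "\<dots> \<le> card ?A"
      using n by (intro count_blowups fin) auto
    finally have A: "?c * ?n ^ ?m \<le> card ?A" .
    have "card ?B = card (concat ` ?B)"
      using inj_on_concat_blowups by (metis (no_types, lifting) card_image inj_on_subset mem_Collect_eq subsetI)
    also have "\<dots> \<le> card (tuples ?m V - {xs\<in>tuples ?m V. distinct xs \<and> set xs \<inter> {} = {}})"
      using concat_blowups[of ts V] fin by (intro card_mono) auto
    also have "\<dots> = card (tuples ?m V) - card {xs\<in>tuples ?m V. distinct xs \<and> set xs \<inter> {} = {}}"
      using fin by (intro card_Diff_subset) auto
    finally have "real (card ?B) \<le> card (tuples ?m V) - real (card {xs\<in>tuples ?m V. distinct xs \<and> set xs \<inter> {} = {}})"
      using card_mono[of "tuples ?m V" "{xs\<in>tuples ?m V. distinct xs \<and> set xs \<inter> {} = {}}"] fin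
      by auto
    also have "\<dots> \<le> ?n ^ ?m - (1 - ?m * ?m / ?n) * ?n ^ ?m"
      using card_clean_tuples[of V "{}" ?m] fin by (simp add: card_tuples)
    also have "\<dots> = (?m\<^sup>2 / ?n) * ?n ^ ?m"
      by (simp add: algebra_simps power2_eq_square)
    also have "\<dots> \<le> (?c / 2) * ?n ^ ?m"
    proof (intro mult_right_mono)
      have "2 * (real ?m)\<^sup>2 / ?c \<le> ?n" using nN by linarith
      then show "?m\<^sup>2 / ?n \<le> ?c / 2"
        using n c by (simp add: field_simps)
    qed (use n in auto)
    finally have B: "real (card ?B) \<le> ?c / 2 * ?n ^ ?m" .
    have "card ?A \<le> card ({yss\<in>blowups ts V. distinct (concat yss) \<and> (\<forall>xs\<in>listset (map set yss). P xs)} \<union> ?B)"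
      using fin by (intro card_mono) auto
    also have "\<dots> \<le> card {yss\<in>blowups ts V. distinct (concat yss) \<and> (\<forall>xs\<in>listset (map set yss). P xs)} + card ?B"
      by (rule card_Un_le)
    finally show "?c / 2 * ?n ^ ?m
        \<le> card {yss\<in>blowups ts V. distinct (concat yss) \<and> (\<forall>xs\<in>listset (map set yss). P xs)}"
      using A B by linarith
  qed
qed

section \<open>Tilings\<close>

text \<open>Tilings as a predicate on the covered set. The inductive form makes disjoint unions,
  refinement of tilings and averaging over the tiles immediate by induction.\<close>

inductive tiled :: "('v set \<Rightarrow> bool) \<Rightarrow> 'v set \<Rightarrow> bool" for Q where
  tiled_empty [simp]: "tiled Q {}"
| tiled_insert: "Q A \<Longrightarrow> A \<inter> X = {} \<Longrightarrow> tiled Q X \<Longrightarrow> tiled Q (A \<union> X)"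

lemma tiled_single: "Q A \<Longrightarrow> tiled Q A"
  using tiled_insert[of Q A "{}"] by simp

lemma tiled_Un: "tiled Q X \<Longrightarrow> tiled Q Y \<Longrightarrow> X \<inter> Y = {} \<Longrightarrow> tiled Q (X \<union> Y)"
proof (induction rule: tiled.induct)
  case (tiled_insert A X)
  then have "tiled Q (A \<union> (X \<union> Y))"
    by (intro tiled.tiled_insert[of Q A "X \<union> Y"]) auto
  then show ?case by (simp add: Un_assoc)
qed simp

lemma tiled_trans:
  assumes "tiled Q X" "\<And>A. Q A \<Longrightarrow> tiled R A"
  shows "tiled R X"
  using assms(1) by induction (auto intro: tiled_Un assms(2))

lemma tiled_UN:
  assumes "finite I" "disjoint_family_on A I" "\<And>i. i \<in> I \<Longrightarrow> tiled Q (A i)"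
  shows "tiled Q (\<Union>i\<in>I. A i)"
  using assms
proof (induction I)
  case (insert i I)
  then show ?case
    by (simp add: disjoint_family_on_insert tiled_Un)
qed simp

lemma tiled_card:
  assumes "tiled Q X" "\<And>A. Q A \<Longrightarrow> finite A \<and> card A = m"
  shows "finite X \<and> m dvd card X"
  using assms(1) by induction (auto simp: card_Un_disjoint assms(2))

text \<open>If the average of g over X exceeds r, then so does its average over some tile; that tile can
  be taken out and leaves a tiled set.\<close>

lemma tiled_average:
  fixes g :: "'v \<Rightarrow> real" and r :: real
  assumes "tiled Q X" "\<And>A. Q A \<Longrightarrow> finite A" "(\<Sum>v\<in>X. g v) > r * card X"
  shows "\<exists>B. Q B \<and> B \<subseteq> X \<and> tiled Q (X - B) \<and> (\<Sum>v\<in>B. g v) > r * card B"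
  using assms(1,3)
proof induction
  case (tiled_insert A X)
  have fin: "finite A" "finite X"
  proof -
    show "finite A" using tiled_insert assms(2) by blast
    show "finite X" using \<open>tiled Q X\<close> by induction (auto simp: assms(2))
  qed
  show ?case
  proof (cases "(\<Sum>v\<in>A. g v) > r * card A")
    case True
    moreover have "A \<union> X - A = X" using tiled_insert by auto
    ultimately show ?thesis using tiled_insert by (metis Un_upper1)
  next
    case False
    have "(\<Sum>v\<in>A \<union> X. g v) = sum g A + sum g X" "card (A \<union> X) = card A + card X"
      using fin tiled_insert by (auto simp: sum.union_disjoint card_Un_disjoint)
    with False tiled_insert.prems have "sum g X > r * card X"
      by (simp add: algebra_simps)
    then obtain B where B: "Q B" "B \<subseteq> X" "tiled Q (X - B)" "(\<Sum>v\<in>B. g v) > r * card B"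
      using tiled_insert.IH by blast
    have "A \<union> X - B = A \<union> (X - B)" using B(2) tiled_insert by auto
    moreover have "tiled Q (A \<union> (X - B))"
      using B tiled_insert by (intro tiled.tiled_insert[of Q A "X - B"]) auto
    ultimately show ?thesis using B by auto
  qed
qed simp

section \<open>Complete k-partite k-graphs\<close>

definition complete_parts :: "'v set set \<Rightarrow> 'v set list \<Rightarrow> bool" where
  "complete_parts E As \<longleftrightarrow> (\<forall>xs\<in>listset As. set xs \<in> E)"

lemma complete_partsD:
  assumes "complete_parts E As" "\<And>i. i < length As \<Longrightarrow> x i \<in> As ! i"
  shows "x ` {..<length As} \<in> E"
proof -
  have "map x [0..<length As] \<in> listset As"
    using assms by (simp add: listset_iff_nth)
  moreover have "set (map x [0..<length As]) = x ` {..<length As}"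
    by auto
  ultimately show ?thesis
    using assms(1) unfolding complete_parts_def by metis
qed

lemma complete_parts_mono:
  assumes "complete_parts E As" "length Bs = length As" "\<And>i. i < length As \<Longrightarrow> Bs ! i \<subseteq> As ! i"
  shows "complete_parts E Bs"
  unfolding complete_parts_def
proof
  fix xs assume "xs \<in> listset Bs"
  then have "xs \<in> listset As"
    using assms(2,3) by (auto simp: listset_iff_nth subset_iff)
  then show "set xs \<in> E"
    using assms(1) by (simp add: complete_parts_def)
qed

text \<open>A vertex z common to two classes would give a transversal that uses z twice, hence an edge
  with fewer vertices than there are classes.\<close>

lemma complete_parts_disjoint:
  assumes uni: "\<forall>e\<in>E. card e = length As" and c: "complete_parts E As" and ne: "\<forall>A\<in>set As. A \<noteq> {}"
    and ij: "i < length As" "j < length As" "i \<noteq> j"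
  shows "As ! i \<inter> As ! j = {}"
proof (rule ccontr)
  assume "As ! i \<inter> As ! j \<noteq> {}"
  then obtain z where z: "z \<in> As ! i" "z \<in> As ! j" by blast
  define x where "x l = (if l = j then z else if l = i then z else SOME a. a \<in> As ! l)" for l
  have "x l \<in> As ! l" if "l < length As" for l
  proof -
    have "As ! l \<noteq> {}" using ne that by simp
    then have "(SOME a. a \<in> As ! l) \<in> As ! l" by (simp add: some_in_eq)
    then show ?thesis using z by (simp add: x_def)
  qed
  then have "x ` {..<length As} \<in> E" by (rule complete_partsD[OF c])
  then have "card (x ` {..<length As}) = card {..<length As}" using uni by simp
  then have "inj_on x {..<length As}" by (rule eq_card_imp_inj_on[rotated]) simp
  moreover have "x i = x j" by (simp add: x_def)
  ultimately show False using ij inj_onD[of x "{..<length As}" i j] by simp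
qed

text \<open>X is the vertex set of a complete k-partite k-graph with t vertices in each class.
  Disjointness of the classes is a consequence of k-uniformity
  (\<open>complete_parts_disjoint\<close>).\<close>

definition balanced_clique :: "nat \<Rightarrow> nat \<Rightarrow> 'v set set \<Rightarrow> 'v set \<Rightarrow> bool" where
  "balanced_clique k t E X \<longleftrightarrow> (\<exists>As. length As = k \<and> (\<forall>A\<in>set As. finite A \<and> card A = t) \<and>
     complete_parts E As \<and> X = \<Union>(set As))"

lemma Union_set_nth: "\<Union>(set As) = (\<Union>i<length As. As ! i)"
  by (auto simp: set_conv_nth)

lemma card_complete_parts:
  assumes uni: "\<forall>e\<in>E. card e = length As" and c: "complete_parts E As"
    and t: "\<forall>A\<in>set As. finite A \<and> card A = t"
  shows "card (\<Union>(set As)) = length As * t"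
proof (cases "t = 0")
  case False
  have ne: "\<forall>A\<in>set As. A \<noteq> {}" using t False by auto
  have "card (\<Union>i<length As. As ! i) = (\<Sum>i<length As. card (As ! i))"
    using t complete_parts_disjoint[OF uni c ne] by (intro card_UN_disjoint) auto
  then show ?thesis using t by (simp add: Union_set_nth)
next
  case True
  then have "\<Union>(set As) = {}" using t by fastforce
  then have "card (\<Union>(set As)) = 0" by (simp only: card.empty)
  then show ?thesis using True by simp
qed

lemma balanced_clique_card:
  assumes "\<forall>e\<in>E. card e = k" "balanced_clique k t E X"
  shows "finite X \<and> card X = k * t"
  using assms card_complete_parts[of E _ t] unfolding balanced_clique_def by fastforce

lemma peel_balanced_clique:
  assumes uni: "\<forall>e\<in>E. card e = length As" and c: "complete_parts E As"
    and T: "\<forall>A\<in>set As. finite A \<and> card A = T" and T0: "T > 0"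
    and C: "\<And>i. i < length As \<Longrightarrow> C i \<subseteq> As ! i \<and> card (C i) = t"
  shows "balanced_clique (length As) (T - t) E (\<Union>(set As) - (\<Union>i<length As. C i))"
  unfolding balanced_clique_def
proof (intro exI conjI)
  let ?Bs = "map (\<lambda>i. As ! i - C i) [0..<length As]"
  show "length ?Bs = length As" by simp
  show "\<forall>B\<in>set ?Bs. finite B \<and> card B = T - t"
  proof
    fix B assume "B \<in> set ?Bs"
    then obtain i where i: "i < length As" "B = As ! i - C i" by auto
    then have "finite (As ! i)" "card (As ! i) = T" using T by auto
    then show "finite B \<and> card B = T - t"
      using C[OF i(1)] i(2) by (auto simp: card_Diff_subset finite_subset)
  qed
  show "complete_parts E ?Bs"
    by (rule complete_parts_mono[OF c]) auto
  have ne: "\<forall>A\<in>set As. A \<noteq> {}" using T T0 by auto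
  show "\<Union>(set As) - (\<Union>i<length As. C i) = \<Union>(set ?Bs)"
  proof
    show "\<Union>(set As) - (\<Union>i<length As. C i) \<subseteq> \<Union>(set ?Bs)"
      by (auto simp: Union_set_nth)
    show "\<Union>(set ?Bs) \<subseteq> \<Union>(set As) - (\<Union>i<length As. C i)"
    proof
      fix v assume "v \<in> \<Union>(set ?Bs)"
      then obtain i where i: "i < length As" "v \<in> As ! i" "v \<notin> C i" by auto
      have "v \<notin> C j" if "j < length As" for j
        using complete_parts_disjoint[OF uni c ne i(1) that] C[OF that] i by (cases "i = j") auto
      with i show "v \<in> \<Union>(set As) - (\<Union>i<length As. C i)" by auto
    qed
  qed
qed

text \<open>Peel off q balanced cliques of class size t one after another.\<close>

lemma balanced_clique_split:
  assumes uni: "\<forall>e\<in>E. card e = k" and t: "t > 0"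
  shows "balanced_clique k (q * t) E X \<Longrightarrow> tiled (balanced_clique k t E) X"
proof (induction q arbitrary: X)
  case 0
  then have "X = {}" unfolding balanced_clique_def by auto
  then show ?case by simp
next
  case (Suc q)
  then obtain As where As: "length As = k" "\<forall>A\<in>set As. finite A \<and> card A = Suc q * t"
      "complete_parts E As" "X = \<Union>(set As)"
    unfolding balanced_clique_def by blast
  have "\<exists>C. C \<subseteq> As ! i \<and> card C = t" if "i < k" for i
  proof -
    have "card (As ! i) \<ge> t" using that As by simp
    then show ?thesis by (metis obtain_subset_with_card_n)
  qed
  then obtain C where C: "\<And>i. i < k \<Longrightarrow> C i \<subseteq> As ! i \<and> card (C i) = t"
    by metis
  have "balanced_clique k (Suc q * t - t) E (X - (\<Union>i<k. C i))"
    using peel_balanced_clique[of E As "Suc q * t" C t] As C uni t by auto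
  then have 1: "tiled (balanced_clique k t E) (X - (\<Union>i<k. C i))"
    using Suc.IH by simp
  have "balanced_clique k t E (\<Union>i<k. C i)"
    unfolding balanced_clique_def
  proof (intro exI conjI)
    show "length (map C [0..<k]) = k" by simp
    show "\<forall>A\<in>set (map C [0..<k]). finite A \<and> card A = t"
      using C t by (auto intro: card_ge_0_finite)
    show "complete_parts E (map C [0..<k])"
      by (rule complete_parts_mono[OF As(3)]) (use C As in auto)
    show "(\<Union>i<k. C i) = \<Union>(set (map C [0..<k]))" by auto
  qed
  moreover have "(\<Union>i<k. C i) \<subseteq> X" using C As by (fastforce simp: Union_set_nth)
  moreover have "tiled (balanced_clique k t E) ((\<Union>i<k. C i) \<union> (X - (\<Union>i<k. C i)))"
    using 1 by (intro tiled_Un tiled_single[of _ "\<Union>i<k. C i"] calculation) auto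
  ultimately show ?case by (simp add: Un_absorb1)
qed

section \<open>Copies of a k-partite k-graph in balanced cliques\<close>

definition spans :: "'a hypergraph \<Rightarrow> 'v set set \<Rightarrow> 'v set \<Rightarrow> bool" where
  "spans K E X \<longleftrightarrow>
     (\<exists>\<phi>. inj_on \<phi> (verts K) \<and> \<phi> ` verts K = X \<and> (\<forall>e\<in>edges K. \<phi> ` e \<in> E))"

text \<open>A k-partite realisation given by the class index of each vertex. The indices start at 0 so
  that classes can be rotated modulo k.\<close>

definition partite_colouring :: "nat \<Rightarrow> 'a hypergraph \<Rightarrow> ('a \<Rightarrow> nat) \<Rightarrow> bool" where
  "partite_colouring k K c \<longleftrightarrow> c ` verts K \<subseteq> {..<k} \<and> (\<forall>e\<in>edges K. e \<subseteq> verts K \<and> bij_betw c e {..<k})"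

lemma spans_card: "finite (verts K) \<Longrightarrow> spans K E X \<Longrightarrow> finite X \<and> card X = card (verts K)"
  by (auto simp: spans_def card_image)

text \<open>An injection that sends the colour classes of K into distinct classes of a complete
  k-partite k-graph maps every edge of K to a transversal, that is, to an edge.\<close>

lemma spans_embedding:
  assumes col: "partite_colouring k K c" and perm: "bij_betw \<pi> {..<k} {..<k}"
    and As: "length As = k" "complete_parts E As"
    and inj: "inj_on \<phi> (verts K)" and in_part: "\<And>v. v \<in> verts K \<Longrightarrow> \<phi> v \<in> As ! \<pi> (c v)"
  shows "spans K E (\<phi> ` verts K)"
  unfolding spans_def
proof (intro exI conjI ballI)
  fix e assume e: "e \<in> edges K"
  then have sub: "e \<subseteq> verts K" and "bij_betw c e {..<k}"
    using col by (auto simp: partite_colouring_def)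
  then have b: "bij_betw (\<pi> \<circ> c) e {..<k}"
    using perm bij_betw_trans by blast
  let ?g = "inv_into e (\<pi> \<circ> c)"
  have g: "bij_betw ?g {..<k} e" by (rule bij_betw_inv_into[OF b])
  have "(\<phi> \<circ> ?g) ` {..<length As} \<in> E"
  proof (rule complete_partsD[OF As(2)])
    fix i assume i: "i < length As"
    then have "?g i \<in> e" using g As by (auto simp: bij_betw_def)
    moreover have "\<pi> (c (?g i)) = i"
      using bij_betw_inv_into_right[OF b, of i] i As by simp
    ultimately show "(\<phi> \<circ> ?g) i \<in> As ! i"
      using in_part[of "?g i"] sub by auto
  qed
  then show "\<phi> ` e \<in> E"
    using g As by (simp only: image_comp[symmetric] bij_betw_def)
qed (use inj in auto)

text \<open>Every class has as many vertices as K, so fix bijections h i from the vertices of K to the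
  i-th class. The j-th copy puts a vertex v of K on h i v, where i is the colour of v rotated
  by j. As j runs through the k rotations, each vertex h i v is used exactly once.\<close>

lemma balanced_clique_tiled_by_copies:
  assumes uni: "\<forall>e\<in>E. card e = k" and k: "k > 0" and finK: "finite (verts K)"
    and b: "card (verts K) = b" "b > 0"
    and col: "partite_colouring k K c" and X: "balanced_clique k b E X"
  shows "tiled (spans K E) X"
proof -
  obtain As where As: "length As = k" "\<forall>A\<in>set As. finite A \<and> card A = b"
      "complete_parts E As" "X = \<Union>(set As)"
    using X unfolding balanced_clique_def by blast
  have ne: "\<forall>A\<in>set As. A \<noteq> {}" using As b by auto
  have disj: "As ! i \<inter> As ! j = {}" if "i < k" "j < k" "i \<noteq> j" for i j
    using complete_parts_disjoint[of E As i j] uni As ne that by auto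
  have "\<exists>h. bij_betw h (verts K) (As ! i)" if "i < k" for i
    using that As finK b by (intro finite_same_card_bij) auto
  then obtain h where h: "\<And>i. i < k \<Longrightarrow> bij_betw (h i) (verts K) (As ! i)"
    by metis
  define rot where "rot j i = (i + j) mod k" for i j
  have rot_lt: "rot j i < k" for i j using k by (simp add: rot_def)
  have rot_le: "i = i'" if "i \<le> i'" "i' < k" "rot j i = rot j i'" for i i' j
  proof -
    have "k dvd (i' + j) - (i + j)"
      using that by (subst mod_eq_dvd_iff_nat[symmetric]) (simp_all add: rot_def)
    then have "k dvd i' - i" by simp
    then have "i' - i = 0" using that by (metis dvd_imp_le leD less_imp_diff_less neq0_conv)
    then show ?thesis using that by simp
  qed
  have rot_inj: "inj_on (rot j) {..<k}" for j
    using rot_le by (intro inj_onI) (metis lessThan_iff nat_le_linear)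
  have rot_bij: "bij_betw (rot j) {..<k} {..<k}" for j
    using rot_inj[of j] rot_lt endo_inj_surj[of "{..<k}" "rot j"] by (auto simp: bij_betw_def)
  have rot_comm: "rot j i = rot i j" for i j by (simp add: rot_def add.commute)
  define \<phi> where "\<phi> j v = h (rot j (c v)) v" for j v
  have clt: "c v < k" if "v \<in> verts K" for v
    using col that by (auto simp: partite_colouring_def)
  have \<phi>_in: "\<phi> j v \<in> As ! rot j (c v)" if "v \<in> verts K" for j v
    using h[OF rot_lt] that unfolding \<phi>_def by (auto simp: bij_betw_def)
  have \<phi>_eq: "rot j (c v) = rot j' (c v') \<and> v = v'"
    if v: "v \<in> verts K" "v' \<in> verts K" "\<phi> j v = \<phi> j' v'" for j j' v v'
  proof -
    have eq: "rot j (c v) = rot j' (c v')"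
      using \<phi>_in[OF v(1), of j] \<phi>_in[OF v(2), of j'] v(3)
        disj[OF rot_lt rot_lt, of j "c v" j' "c v'"] by auto
    have "inj_on (h (rot j (c v))) (verts K)"
      using h[OF rot_lt] by (simp add: bij_betw_def)
    then have "v = v'"
      using v eq inj_onD[of "h (rot j (c v))" "verts K" v v'] unfolding \<phi>_def by simp
    with eq show ?thesis by simp
  qed
  have sp: "spans K E (\<phi> j ` verts K)" for j
  proof (rule spans_embedding[OF col rot_bij As(1,3)])
    show "inj_on (\<phi> j) (verts K)"
      by (rule inj_onI) (metis \<phi>_eq)
  qed (rule \<phi>_in)
  have "disjoint_family_on (\<lambda>j. \<phi> j ` verts K) {..<k}"
    unfolding disjoint_family_on_def
  proof (intro ballI impI)
    fix j j' assume j: "j \<in> {..<k}" "j' \<in> {..<k}" "j \<noteq> j'"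
    show "\<phi> j ` verts K \<inter> \<phi> j' ` verts K = {}"
    proof (rule ccontr)
      assume "\<phi> j ` verts K \<inter> \<phi> j' ` verts K \<noteq> {}"
      then obtain v v' where v: "v \<in> verts K" "v' \<in> verts K" "\<phi> j v = \<phi> j' v'" by blast
      then have "rot (c v) j = rot (c v) j'"
        using \<phi>_eq[OF v] rot_comm by metis
      then show False using inj_onD[OF rot_inj, of "c v" j j'] j by simp
    qed
  qed
  then have "tiled (spans K E) (\<Union>j\<in>{..<k}. \<phi> j ` verts K)"
    by (intro tiled_UN tiled_single sp) auto
  moreover have "(\<Union>j\<in>{..<k}. \<phi> j ` verts K) = X"
  proof
    show "(\<Union>j\<in>{..<k}. \<phi> j ` verts K) \<subseteq> X"
      using \<phi>_in rot_lt As by (fastforce simp: Union_set_nth)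
    show "X \<subseteq> (\<Union>j\<in>{..<k}. \<phi> j ` verts K)"
    proof
      fix w assume "w \<in> X"
      then obtain i where i: "i < k" "w \<in> As ! i" using As by (auto simp: Union_set_nth)
      then obtain v where v: "v \<in> verts K" "w = h i v" using h[of i] by (auto simp: bij_betw_def)
      have "i \<in> rot (c v) ` {..<k}"
        using rot_bij[of "c v"] i by (simp add: bij_betw_def)
      then obtain j where j: "j < k" "rot (c v) j = i" by auto
      then have "w = \<phi> j v" using v rot_comm by (simp add: \<phi>_def)
      with v(1) j(1) show "w \<in> (\<Union>j\<in>{..<k}. \<phi> j ` verts K)" by blast
    qed
  qed
  ultimately show ?thesis by simp
qed

lemma spans_complete_parts:
  assumes uni: "\<forall>e\<in>E. card e = k" and finK: "finite (verts K)"
    and col: "partite_colouring k K c" and ne: "edges K \<noteq> {}"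
    and As: "length As = k" "complete_parts E As"
    and sizes: "\<And>i. i < k \<Longrightarrow> finite (As ! i) \<and> card (As ! i) = card {v\<in>verts K. c v = i}"
  shows "spans K E (\<Union>(set As))"
proof -
  have clt: "c v < k" if "v \<in> verts K" for v
    using col that by (auto simp: partite_colouring_def)
  obtain e where e: "e \<in> edges K" using ne by blast
  have "As ! i \<noteq> {}" if "i < k" for i
  proof -
    have "e \<subseteq> verts K" "bij_betw c e {..<k}" using col e by (auto simp: partite_colouring_def)
    then have "i \<in> c ` e" using that by (simp add: bij_betw_def)
    then obtain v where "v \<in> verts K" "c v = i"
      using \<open>e \<subseteq> verts K\<close> by blast
    then have "card {v\<in>verts K. c v = i} \<noteq> 0" using finK by auto
    then show ?thesis using sizes[OF that] by auto
  qed
  then have ne: "\<forall>A\<in>set As. A \<noteq> {}" using As by (auto simp: in_set_conv_nth)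
  have disj: "As ! i \<inter> As ! j = {}" if "i < k" "j < k" "i \<noteq> j" for i j
    using complete_parts_disjoint[of E As i j] uni As ne that by auto
  have "\<exists>h. bij_betw h {v\<in>verts K. c v = i} (As ! i)" if "i < k" for i
    using sizes[OF that] finK by (intro finite_same_card_bij) auto
  then obtain h where h: "\<And>i. i < k \<Longrightarrow> bij_betw (h i) {v\<in>verts K. c v = i} (As ! i)"
    by metis
  define \<phi> where "\<phi> v = h (c v) v" for v
  have \<phi>_in: "\<phi> v \<in> As ! c v" if "v \<in> verts K" for v
    using h[OF clt[OF that]] that unfolding \<phi>_def by (auto simp: bij_betw_def)
  have inj: "inj_on \<phi> (verts K)"
  proof (rule inj_onI)
    fix v v' assume v: "v \<in> verts K" "v' \<in> verts K" "\<phi> v = \<phi> v'"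
    have "c v = c v'"
      using \<phi>_in[OF v(1)] \<phi>_in[OF v(2)] v(3) disj[OF clt[OF v(1)] clt[OF v(2)]] by fastforce
    then show "v = v'"
      using v inj_onD[OF bij_betw_imp_inj_on[OF h[OF clt[OF v(1)]]], of v v'] unfolding \<phi>_def by simp
  qed
  have "spans K E (\<phi> ` verts K)"
    using spans_embedding[OF col bij_betw_id As inj] \<phi>_in by simp
  moreover have "\<phi> ` verts K = \<Union>(set As)"
  proof
    show "\<phi> ` verts K \<subseteq> \<Union>(set As)" using \<phi>_in clt As by (fastforce simp: Union_set_nth)
    show "\<Union>(set As) \<subseteq> \<phi> ` verts K"
    proof
      fix w assume "w \<in> \<Union>(set As)"
      then obtain i where "i < k" "w \<in> As ! i" using As by (auto simp: Union_set_nth)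
      then show "w \<in> \<phi> ` verts K"
        using h[of i] by (auto simp: bij_betw_def \<phi>_def image_iff)
    qed
  qed
  ultimately show ?thesis by simp
qed

lemma kpartite_colouring:
  assumes "kgraph k K" "kpartite k K"
  obtains c where "partite_colouring k K c"
proof -
  obtain U where "partite_realisation k K U"
    using assms(2) unfolding kpartite_def by blast
  then have U: "disjoint_family_on U {1..k}" "(\<Union>j\<in>{1..k}. U j) = verts K"
    "\<And>e j. e \<in> edges K \<Longrightarrow> j \<in> {1..k} \<Longrightarrow> card (e \<inter> U j) = 1"
    unfolding partite_realisation_def by simp_all
  define c where "c v = (THE i. i < k \<and> v \<in> U (Suc i))" for v
  have c: "c v = i" if "i < k" "v \<in> U (Suc i)" for v i
    unfolding c_def
  proof (rule the_equality)
    fix j assume "j < k \<and> v \<in> U (Suc j)"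
    then have "Suc j \<in> {1..k}" "v \<in> U (Suc j)" "Suc i \<in> {1..k}" using that by auto
    then have "Suc j = Suc i" using disjoint_family_onD[OF U(1)] that(2) by blast
    then show "j = i" by simp
  qed (use that in auto)
  have cU: "c v < k \<and> v \<in> U (Suc (c v))" if "v \<in> verts K" for v
  proof -
    have "v \<in> (\<Union>j\<in>{1..k}. U j)" using U(2) that by simp
    then obtain j where "j \<in> {1..k}" "v \<in> U j" by auto
    then have "j - 1 < k" "v \<in> U (Suc (j - 1))" by auto
    then show ?thesis using c[of "j - 1" v] by simp
  qed
  have "bij_betw c e {..<k}" if e: "e \<in> edges K" for e
  proof -
    have e': "e \<subseteq> verts K" "card e = k" "finite (verts K)"
      using assms(1) e unfolding kgraph_def by auto
    then have fe: "finite e" using finite_subset by blast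
    have "{..<k} \<subseteq> c ` e"
    proof
      fix i assume "i \<in> {..<k}"
      then have "card (e \<inter> U (Suc i)) = 1" using U(3)[OF e, of "Suc i"] by auto
      then obtain v where "v \<in> e" "v \<in> U (Suc i)" by (metis IntE card_1_singletonE insertI1)
      then show "i \<in> c ` e" using c[of i v] \<open>i \<in> {..<k}\<close> by auto
    qed
    moreover have "c ` e \<subseteq> {..<k}" using cU e' by blast
    ultimately have "c ` e = {..<k}" by blast
    then show ?thesis using e' fe by (simp add: bij_betw_def eq_card_imp_inj_on)
  qed
  moreover have "c ` verts K \<subseteq> {..<k}" using cU by blast
  moreover have "\<forall>e\<in>edges K. e \<subseteq> verts K" using assms(1) by (simp add: kgraph_def)
  ultimately have "partite_colouring k K c"
    unfolding partite_colouring_def by simp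
  then show ?thesis by (rule that)
qed

section \<open>Exchanging a clique of the tiling\<close>

text \<open>The codegree hypothesis for a vertex set V; the edges in E may leave V. In this form it
  passes to V - A for small A without changing E.\<close>

definition half_codegree :: "nat \<Rightarrow> 'v set set \<Rightarrow> real \<Rightarrow> 'v set \<Rightarrow> bool" where
  "half_codegree k E \<alpha> V \<longleftrightarrow> finite V \<and> (\<forall>e\<in>E. card e = k) \<and>
     (\<forall>S\<subseteq>V. card S = k - 1 \<longrightarrow> (1/2 + \<alpha>) * card V \<le> card {v\<in>V. insert v S \<in> E})"

lemma half_codegreeD:
  assumes "half_codegree k E \<alpha> V"
  shows "finite V" "\<forall>e\<in>E. card e = k"
    and "\<And>S. S \<subseteq> V \<Longrightarrow> card S = k - 1 \<Longrightarrow> (1/2 + \<alpha>) * card V \<le> card {v\<in>V. insert v S \<in> E}"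
  using assms unfolding half_codegree_def by simp_all

text \<open>If at most one class met W in t or more vertices, W would have fewer than T + (k-1)t = 3T/2
  vertices, where T = 2(k-1)t is the class size. But |W| is at least kT/2, and k is at least
  3. This is where k > 2 enters the proof, and it explains the choice of T.\<close>

lemma two_heavy_classes:
  assumes k: "k \<ge> 3" and As: "length As = k" "\<forall>A\<in>set As. finite A \<and> card A = 2 * (k - 1) * t"
    and t: "t > 0" and W: "W \<subseteq> \<Union>(set As)" "k * (2 * (k - 1) * t) \<le> 2 * card W"
  shows "\<exists>i<k. \<exists>j<k. i \<noteq> j \<and> t \<le> card (W \<inter> As ! i) \<and> t \<le> card (W \<inter> As ! j)"
proof (rule ccontr)
  assume neg: "\<not> ?thesis"
  define a where "a i = card (W \<inter> As ! i)" for i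
  obtain i0 where i0: "i0 < k" "\<And>i. i < k \<Longrightarrow> i \<noteq> i0 \<Longrightarrow> a i \<le> t - 1"
  proof (cases "\<exists>i<k. t \<le> a i")
    case True
    then obtain i where "i < k" "t \<le> a i" by blast
    moreover have "a j \<le> t - 1" if "j < k" "j \<noteq> i" for j
      using neg that calculation unfolding a_def by force
    ultimately show ?thesis using that by blast
  next
    case False
    have "a j \<le> t - 1" if "j < k" for j
      using False that by force
    moreover have "0 < k" using k by simp
    ultimately show ?thesis using that by blast
  qed
  let ?T = "2 * (k - 1) * t"
  have "W = (\<Union>i<k. W \<inter> As ! i)" using W(1) As(1) by (auto simp: Union_set_nth)
  then have "card W = card (\<Union>i<k. W \<inter> As ! i)" by (rule arg_cong)
  also have "\<dots> \<le> (\<Sum>i<k. a i)" unfolding a_def by (rule card_UN_le) simp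
  also have "\<dots> = a i0 + (\<Sum>i\<in>{..<k} - {i0}. a i)"
    using i0(1) by (subst sum.remove[of _ i0]) auto
  also have "(\<Sum>i\<in>{..<k} - {i0}. a i) \<le> (\<Sum>i\<in>{..<k} - {i0}. t - 1)"
    using i0(2) by (intro sum_mono) auto
  also have "(\<Sum>i\<in>{..<k} - {i0}. t - 1) = (k - 1) * (t - 1)"
    using i0(1) by simp
  also have "a i0 \<le> ?T"
  proof -
    have "finite (As ! i0)" "card (As ! i0) = ?T" using As i0 by auto
    then show ?thesis unfolding a_def by (metis card_mono inf_le2)
  qed
  finally have "card W \<le> ?T + (k - 1) * (t - 1)" by simp
  moreover have "(k - 1) * (t - 1) < (k - 1) * t" using k t by simp
  moreover have "3 * ?T \<le> k * ?T" using k by (intro mult_right_mono) auto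
  ultimately show False using W(2) by linarith
qed

text \<open>The exchange step. As holds the classes of a clique B of class size T, and every vertex of W
  is joined to all transversals of Ds. Take t-sets C i and C j inside W in two classes of B,
  complete each to a clique with one half of every class in Ds, and keep the clique of class
  size T - t that remains of B after a t-set has been removed from each class. Together they
  cover kT + kt vertices.\<close>

lemma exchange:
  assumes k: "k \<ge> 3" and uni: "\<forall>e\<in>E. card e = k" and t: "t > 0"
    and As: "length As = k" "\<forall>A\<in>set As. finite A \<and> card A = 2 * (k - 1) * t" "complete_parts E As"
    and Ds: "length Ds = k - 1" "\<forall>D\<in>set Ds. finite D \<and> card D = 2 * t" "\<Union>(set Ds) \<subseteq> L"
    and L: "L \<inter> \<Union>(set As) = {}"
    and W: "W \<subseteq> \<Union>(set As)" "k * (2 * (k - 1) * t) \<le> 2 * card W"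
    and WD: "\<And>w xs. w \<in> W \<Longrightarrow> xs \<in> listset Ds \<Longrightarrow> insert w (set xs) \<in> E"
  shows "\<exists>D. D \<subseteq> \<Union>(set As) \<union> L \<and> tiled (balanced_clique k t E) D \<and>
    card D = k * (2 * (k - 1) * t) + k * t"
proof -
  let ?T = "2 * (k - 1) * t" and ?B = "\<Union>(set As)"
  obtain i j where ij: "i < k" "j < k" "i \<noteq> j" "t \<le> card (W \<inter> As ! i)" "t \<le> card (W \<inter> As ! j)"
    using two_heavy_classes[OF k As(1,2) t W] by blast
  have tT: "t \<le> ?T" using k t by simp
  have "\<exists>C. C \<subseteq> As ! l \<and> card C = t \<and> (l = i \<or> l = j \<longrightarrow> C \<subseteq> W)" if "l < k" for l
  proof (cases "l = i \<or> l = j")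
    case True
    then have "t \<le> card (W \<inter> As ! l)" using ij by auto
    then obtain C where "C \<subseteq> W \<inter> As ! l" "card C = t" by (metis obtain_subset_with_card_n)
    then show ?thesis by blast
  next
    case False
    have "t \<le> card (As ! l)" using As that tT by simp
    then obtain C where "C \<subseteq> As ! l" "card C = t" by (metis obtain_subset_with_card_n)
    then show ?thesis using False by blast
  qed
  then obtain C where C: "\<And>l. l < k \<Longrightarrow> C l \<subseteq> As ! l \<and> card (C l) = t \<and> (l = i \<or> l = j \<longrightarrow> C l \<subseteq> W)"
    by metis
  let ?R = "?B - (\<Union>l<k. C l)"
  have "balanced_clique k (?T - t) E ?R"
    using peel_balanced_clique[of E As ?T C t] As C uni t k by simp
  moreover have "?T - t = (2 * (k - 1) - 1) * t" by (simp add: diff_mult_distrib)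
  ultimately have R: "balanced_clique k ((2 * (k - 1) - 1) * t) E ?R" by simp
  have "W \<noteq> {}" using W(2) t k by auto
  then obtain w where w: "w \<in> W" by blast
  have Dne: "\<forall>D\<in>set Ds. D \<noteq> {}" using Ds t by auto
  have comp: "complete_parts E (C' # Ds)" if "C' \<subseteq> W" for C'
    using WD that unfolding complete_parts_def by (auto simp: set_Cons_def)
  have Ddisj: "Ds ! m \<inter> Ds ! m' = {}" if "m < k - 1" "m' < k - 1" "m \<noteq> m'" for m m'
  proof -
    have "({w} # Ds) ! Suc m \<inter> ({w} # Ds) ! Suc m' = {}"
      by (rule complete_parts_disjoint[of E])
         (use comp[of "{w}"] w Dne that Ds uni k in auto)
    then show ?thesis by simp
  qed
  have "\<exists>P. P \<subseteq> Ds ! m \<and> card P = t" if "m < k - 1" for m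
  proof -
    have "t \<le> card (Ds ! m)" using Ds that by simp
    then show ?thesis by (metis obtain_subset_with_card_n)
  qed
  then obtain P where P: "\<And>m. m < k - 1 \<Longrightarrow> P m \<subseteq> Ds ! m \<and> card (P m) = t" by metis
  define P' where "P' m = Ds ! m - P m" for m
  have P': "P' m \<subseteq> Ds ! m \<and> card (P' m) = t" if "m < k - 1" for m
  proof -
    have "finite (Ds ! m)" "card (Ds ! m) = 2 * t" using Ds that by auto
    moreover have "finite (P m)" using P[OF that] calculation finite_subset by blast
    ultimately show ?thesis using P[OF that] by (simp add: P'_def card_Diff_subset)
  qed
  have clique: "balanced_clique k t E (C l \<union> (\<Union>m<k-1. Q m))"
    if l: "l < k" "C l \<subseteq> W" and Q: "\<And>m. m < k - 1 \<Longrightarrow> Q m \<subseteq> Ds ! m \<and> card (Q m) = t" for l Q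
    unfolding balanced_clique_def
  proof (intro exI conjI)
    let ?Ls = "C l # map Q [0..<k-1]"
    show "length ?Ls = k" using k by simp
    show "\<forall>A\<in>set ?Ls. finite A \<and> card A = t"
      using C[OF l(1)] Q t by (auto intro: card_ge_0_finite)
    show "complete_parts E ?Ls"
    proof (rule complete_parts_mono[OF comp[OF l(2)]])
      fix n assume "n < length (C l # Ds)"
      then show "?Ls ! n \<subseteq> (C l # Ds) ! n"
        using Q Ds by (cases n) auto
    qed (use Ds in simp)
    show "C l \<union> (\<Union>m<k-1. Q m) = \<Union>(set ?Ls)" by auto
  qed
  let ?P1 = "C i \<union> (\<Union>m<k-1. P m)" and ?P2 = "C j \<union> (\<Union>m<k-1. P' m)"
  have P1: "balanced_clique k t E ?P1" using ij C P by (intro clique) auto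
  have P2: "balanced_clique k t E ?P2" using ij C P' by (intro clique) auto
  have Asne: "\<forall>A\<in>set As. A \<noteq> {}" using As t tT by auto
  have Cij: "C i \<inter> C j = {}"
    using complete_parts_disjoint[of E As i j] uni As Asne ij C[OF ij(1)] C[OF ij(2)] by auto
  have CB: "C l \<subseteq> ?B" if "l < k" for l using C[OF that] that As by (auto simp: Union_set_nth)
  have PL: "P m \<subseteq> L \<and> P' m \<subseteq> L" if "m < k - 1" for m
  proof -
    have "Ds ! m \<in> set Ds" using Ds(1) that by simp
    then have "Ds ! m \<subseteq> L" using Ds(3) by blast
    then show ?thesis using P[OF that] P'[OF that] by blast
  qed
  have PP: "P m \<inter> P' m' = {}" if "m < k - 1" "m' < k - 1" for m m'
    using Ddisj[OF that] P[OF that(1)] P'[OF that(2)] by (cases "m = m'") (auto simp: P'_def)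
  have PL1: "(\<Union>m<k-1. P m) \<subseteq> L" "(\<Union>m<k-1. P' m) \<subseteq> L" using PL by auto
  have PP1: "(\<Union>m<k-1. P m) \<inter> (\<Union>m<k-1. P' m) = {}" using PP by auto
  have CL: "C l \<inter> (\<Union>m<k-1. P m) = {} \<and> C l \<inter> (\<Union>m<k-1. P' m) = {}" if "l < k" for l
    using CB[OF that] PL1 L by (meson Int_mono Int_commute disjoint_iff subsetD)
  have d12: "?P1 \<inter> ?P2 = {}"
    using Cij PP1 CL[OF ij(1)] CL[OF ij(2)] by (simp only: Int_Un_distrib Int_Un_distrib2) (simp add: Int_commute)
  have RL: "?R \<inter> (\<Union>m<k-1. P m) = {} \<and> ?R \<inter> (\<Union>m<k-1. P' m) = {}"
    using PL1 L by (meson Diff_subset disjoint_iff subsetD)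
  have RC: "?R \<inter> C l = {}" if "l < k" for l
    using that by auto
  have dR: "?R \<inter> (?P1 \<union> ?P2) = {}"
    using RL RC[OF ij(1)] RC[OF ij(2)] by (simp only: Int_Un_distrib) simp
  have tP: "tiled (balanced_clique k t E) (?P1 \<union> ?P2)"
    by (intro tiled_Un tiled_single P1 P2 d12)
  have "tiled (balanced_clique k t E) (?R \<union> (?P1 \<union> ?P2))"
    by (intro tiled_Un tP dR balanced_clique_split[OF uni t R])
  moreover have "?R \<union> (?P1 \<union> ?P2) \<subseteq> ?B \<union> L"
    using PL1 CB[OF ij(1)] CB[OF ij(2)] by (meson Diff_subset Un_least le_supI1 le_supI2)
  moreover have "card (?R \<union> (?P1 \<union> ?P2)) = k * ?T + k * t"
  proof -
    have "card (?P1 \<union> ?P2) = k * t + k * t"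
      using balanced_clique_card[OF uni P1] balanced_clique_card[OF uni P2] d12
      by (simp add: card_Un_disjoint)
    moreover have "card ?R = k * ((2 * (k - 1) - 1) * t)" "finite ?R"
      using balanced_clique_card[OF uni R] by auto
    moreover have "finite (?P1 \<union> ?P2)"
      using balanced_clique_card[OF uni P1] balanced_clique_card[OF uni P2] by simp
    ultimately have "card (?R \<union> (?P1 \<union> ?P2)) = k * ((2 * (k - 1) - 1) * t) + (k * t + k * t)"
      using dR by (simp only: card_Un_disjoint)
    also have "\<dots> = k * (((2 * (k - 1) - 1) + 1) * t) + k * t"
      by (simp add: algebra_simps)
    also have "(2 * (k - 1) - 1) + 1 = 2 * (k - 1)" using k by simp
    finally show ?thesis .
  qed
  ultimately show ?thesis by blast
qed

text \<open>On average an x in D has more than half of B as its neighbours, so a proportion at least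
  \<open>\<gamma>\<close> of D has at least half of B as neighbours. There are 2^|B| possible
  neighbourhoods, so one of them is shared by many elements of D.\<close>

lemma common_neighbourhood:
  fixes e :: "'b \<Rightarrow> 'c \<Rightarrow> bool" and \<gamma> :: real
  assumes fin: "finite D" "finite B" and B: "B \<noteq> {}"
    and avg: "(\<Sum>v\<in>B. real (card {x\<in>D. e v x})) > (1/2 + \<gamma>) * card D * card B"
    and \<gamma>: "\<gamma> > 0"
  shows "\<exists>W\<subseteq>B. card B \<le> 2 * card W \<and>
    \<gamma> * card D / 2 ^ card B \<le> card {x\<in>D. \<forall>w\<in>W. e w x}"
proof -
  let ?M = "card B"
  define nb where "nb x = {v\<in>B. e v x}" for x
  define H where "H = {x\<in>D. ?M \<le> 2 * card (nb x)}"
  have M: "?M > 0" using B fin by (simp add: card_gt_0_iff)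
  have nbB: "nb x \<subseteq> B" for x by (auto simp: nb_def)
  have finH: "finite H" using fin by (simp add: H_def)
  have "(\<Sum>v\<in>B. real (card {x\<in>D. e v x})) = (\<Sum>x\<in>D. real (card (nb x)))"
    unfolding nb_def using fin by (simp add: real_card_filter) (rule sum.swap)
  also have "\<dots> \<le> (\<Sum>x\<in>D. (if x \<in> H then real ?M else 0) + ?M / 2)"
  proof (rule sum_mono)
    fix x assume "x \<in> D"
    have "card (nb x) \<le> ?M" using nbB fin by (simp add: card_mono)
    then show "real (card (nb x)) \<le> (if x \<in> H then real ?M else 0) + ?M / 2"
      using \<open>x \<in> D\<close> by (auto simp: H_def)
  qed
  also have "\<dots> = card H * ?M + card D * (?M / 2)"
  proof -
    have "D \<inter> {x. x \<in> H} = H" by (auto simp: H_def)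
    then show ?thesis using fin by (simp add: sum.distrib sum.If_cases)
  qed
  finally have "(1/2 + \<gamma>) * card D * ?M < card H * ?M + card D * (?M / 2)"
    using avg by linarith
  then have "(\<gamma> * card D) * ?M < card H * real ?M" by (simp add: algebra_simps)
  then have H: "\<gamma> * card D < card H" using M by simp
  have "\<exists>W\<in>Pow B. \<gamma> * card D / 2 ^ ?M < card {x\<in>H. nb x = W}"
  proof (rule ccontr)
    assume "\<not> ?thesis"
    then have "(\<Sum>W\<in>Pow B. real (card {x\<in>H. nb x = W})) \<le> (\<Sum>W\<in>Pow B. \<gamma> * card D / 2 ^ ?M)"
      by (intro sum_mono) (simp add: not_less)
    also have "\<dots> = \<gamma> * card D" using fin by (simp add: card_Pow)
    also have "(\<Sum>W\<in>Pow B. real (card {x\<in>H. nb x = W})) = real (card (\<Union>W\<in>Pow B. {x\<in>H. nb x = W}))"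
      using fin finH by (subst card_UN_disjoint) auto
    also have "(\<Union>W\<in>Pow B. {x\<in>H. nb x = W}) = H" using nbB by auto
    finally show False using H by simp
  qed
  then obtain W where W: "W \<subseteq> B" "\<gamma> * card D / 2 ^ ?M < card {x\<in>H. nb x = W}" by auto
  have "\<gamma> * card D / 2 ^ ?M \<ge> 0" using \<gamma> by simp
  then have "{x\<in>H. nb x = W} \<noteq> {}" using W(2) by fastforce
  then have "?M \<le> 2 * card W" by (auto simp: H_def)
  moreover have "card {x\<in>H. nb x = W} \<le> card {x\<in>D. \<forall>w\<in>W. e w x}"
    using fin by (intro card_mono) (auto simp: H_def nb_def)
  ultimately show ?thesis using W by (intro exI[of _ W]) auto
qed

lemma blowup_parts:
  assumes "yss \<in> blowups ts V" "distinct (concat yss)"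
  shows "length (map set yss) = length ts"
    and "\<And>i. i < length ts \<Longrightarrow> finite (map set yss ! i) \<and> card (map set yss ! i) = ts ! i"
    and "\<Union>(set (map set yss)) \<subseteq> V"
proof -
  have l: "map length yss = ts" using assms blowups_lengths by blast
  then have len: "length yss = length ts" by (metis length_map)
  then show "length (map set yss) = length ts" by simp
  show "finite (map set yss ! i) \<and> card (map set yss ! i) = ts ! i" if "i < length ts" for i
  proof -
    have "yss ! i \<in> set yss" using that len by simp
    then have "distinct (yss ! i)" using assms(2) by (simp add: distinct_concat_iff)
    moreover have "length (yss ! i) = ts ! i" using l that len by (metis nth_map)
    ultimately show ?thesis using that len by (simp add: distinct_card)
  qed
  show "\<Union>(set (map set yss)) \<subseteq> V" using blowups_subset[OF assms(1)] by simp
qed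

lemma dense_parts:
  fixes d :: real
  assumes "d > 0"
  shows "\<exists>N. \<forall>V :: 'v set. \<forall>P. finite V \<longrightarrow> card V \<ge> N \<longrightarrow>
    card {xs\<in>tuples (length ts) V. P xs} \<ge> d * real (card V) ^ length ts \<longrightarrow>
    (\<exists>As. length As = length ts \<and> (\<forall>i<length ts. finite (As ! i) \<and> card (As ! i) = ts ! i) \<and>
       \<Union>(set As) \<subseteq> V \<and> (\<forall>xs\<in>listset As. P xs))"
proof -
  obtain N where N: "\<And>(V :: 'v set) P. finite V \<Longrightarrow> card V \<ge> N \<Longrightarrow>
    card {xs\<in>tuples (length ts) V. P xs} \<ge> d * real (card V) ^ length ts \<Longrightarrow>
    card {yss\<in>blowups ts V. distinct (concat yss) \<and> (\<forall>xs\<in>listset (map set yss). P xs)}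
      \<ge> d ^ prod_list ts / 2 * real (card V) ^ sum_list ts"
    using many_distinct_blowups[OF assms] by blast
  show ?thesis
  proof (intro exI[of _ "Suc N"] allI impI)
    fix V :: "'v set" and P
    assume *: "finite V" "card V \<ge> Suc N"
      "card {xs\<in>tuples (length ts) V. P xs} \<ge> d * real (card V) ^ length ts"
    have "0 < d ^ prod_list ts / 2 * real (card V) ^ sum_list ts" using assms * by simp
    also have "\<dots> \<le> card {yss\<in>blowups ts V. distinct (concat yss) \<and> (\<forall>xs\<in>listset (map set yss). P xs)}"
      using * by (intro N) auto
    finally have "{yss\<in>blowups ts V. distinct (concat yss) \<and> (\<forall>xs\<in>listset (map set yss). P xs)} \<noteq> {}"
      by fastforce
    then obtain yss where y: "yss \<in> blowups ts V" "distinct (concat yss)"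
      "\<forall>xs\<in>listset (map set yss). P xs" by blast
    show "\<exists>As. length As = length ts \<and> (\<forall>i<length ts. finite (As ! i) \<and> card (As ! i) = ts ! i) \<and>
       \<Union>(set As) \<subseteq> V \<and> (\<forall>xs\<in>listset As. P xs)"
      using blowup_parts[OF y(1,2)] y(3) by (intro exI[of _ "map set yss"]) simp
  qed
qed

section \<open>Almost perfect tilings by balanced cliques\<close>

text \<open>One improvement step for a partial tiling by large cliques (covering Y) and small cliques
  (covering Z). If the uncovered set L contains no small clique, it has few edges. As Z is
  small too, the degrees of the (k-1)-tuples of L go mostly into Y, at a rate above one half,
  and \<open>common_neighbourhood\<close> applied to a clique B of above-average degree
  supplies the input of \<open>exchange\<close>.\<close>

lemma augmentation:
  fixes \<alpha> \<epsilon> :: real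
  assumes k: "k \<ge> 3" and t: "t > 0" and \<alpha>: "\<alpha> > 0" and \<epsilon>: "\<epsilon> > 0"
  shows "\<exists>N. \<forall>(V :: 'v set) E Y Z. half_codegree k E \<alpha> V \<longrightarrow> card V \<ge> N \<longrightarrow>
    tiled (balanced_clique k (2 * (k - 1) * t) E) Y \<longrightarrow> Y \<union> Z \<subseteq> V \<longrightarrow> Y \<inter> Z = {} \<longrightarrow>
    card Z \<le> \<alpha> / 4 * card V \<longrightarrow> \<epsilon> * card V \<le> card (V - (Y \<union> Z)) \<longrightarrow>
    (\<exists>A \<subseteq> V - (Y \<union> Z). balanced_clique k t E A) \<or>
    (\<exists>B D. B \<subseteq> Y \<and> balanced_clique k (2 * (k - 1) * t) E B \<and>
       tiled (balanced_clique k (2 * (k - 1) * t) E) (Y - B) \<and>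
       D \<subseteq> B \<union> (V - (Y \<union> Z)) \<and> tiled (balanced_clique k t E) D \<and>
       card D = k * (2 * (k - 1) * t) + k * t)"
proof -
  let ?T = "2 * (k - 1) * t"
  let ?M = "k * ?T"
  \<comment> \<open>a density of (k-1)-tuples with a common neighbourhood: \<alpha>/4 from the excess
    degree, the power of 2 from the pigeonhole, the last factor 2 from the tuples with
    repetitions\<close>
  define d2 where "d2 = \<alpha> / 4 / 2 ^ ?M / 2"
  have d2: "d2 > 0" using \<alpha> by (simp add: d2_def)
  obtain N1 where N1: "\<And>(L :: 'v set) P. finite L \<Longrightarrow> card L \<ge> N1 \<Longrightarrow>
    card {xs\<in>tuples k L. P xs} \<ge> \<alpha> / 16 * real (card L) ^ k \<Longrightarrow>
    \<exists>As. length As = k \<and> (\<forall>i<k. finite (As ! i) \<and> card (As ! i) = t) \<and>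
       \<Union>(set As) \<subseteq> L \<and> (\<forall>xs\<in>listset As. P xs)"
    using dense_parts[of "\<alpha> / 16" "replicate k t"] \<alpha> by auto
  obtain N2 where N2: "\<And>(L :: 'v set) P. finite L \<Longrightarrow> card L \<ge> N2 \<Longrightarrow>
    card {xs\<in>tuples (k - 1) L. P xs} \<ge> d2 * real (card L) ^ (k - 1) \<Longrightarrow>
    \<exists>As. length As = k - 1 \<and> (\<forall>i<k - 1. finite (As ! i) \<and> card (As ! i) = 2 * t) \<and>
       \<Union>(set As) \<subseteq> L \<and> (\<forall>xs\<in>listset As. P xs)"
    using dense_parts[of d2 "replicate (k - 1) (2 * t)"] d2 by auto
  \<comment> \<open>the term 2 k k makes at least half of the (k-1)-tuples of L free of repetitions\<close>
  define N0 where "N0 = N1 + N2 + 2 * k * k"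
  obtain N :: nat where N: "N0 / \<epsilon> \<le> N"
    using real_arch_simple by blast
  show ?thesis
  proof (intro exI[of _ "Suc N"] allI impI)
    fix V :: "'v set" and E Y Z
    assume hc: "half_codegree k E \<alpha> V" and nN: "Suc N \<le> card V"
      and Y: "tiled (balanced_clique k ?T E) Y" and YZ: "Y \<union> Z \<subseteq> V" "Y \<inter> Z = {}"
      and Zs: "card Z \<le> \<alpha> / 4 * card V" and Ls: "\<epsilon> * card V \<le> card (V - (Y \<union> Z))"
    let ?n = "real (card V)"
    define L where "L = V - (Y \<union> Z)"
    let ?l = "real (card L)"
    have fin: "finite V" and uni: "\<forall>e\<in>E. card e = k"
      and deg: "\<And>S. S \<subseteq> V \<Longrightarrow> card S = k - 1 \<Longrightarrow> (1/2 + \<alpha>) * ?n \<le> card {v\<in>V. insert v S \<in> E}"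
      using hc unfolding half_codegree_def by auto
    have finL: "finite L" and finY: "finite Y" and finZ: "finite Z"
      using fin YZ by (auto simp: L_def intro: finite_subset)
    have n: "?n > 0" using nN by linarith
    have "N0 / \<epsilon> \<le> ?n" using N nN by linarith
    then have "real N0 \<le> \<epsilon> * ?n" using \<epsilon> by (simp add: field_simps)
    then have "real N0 \<le> ?l" using Ls by (simp add: L_def)
    then have lN0: "N0 \<le> card L" by simp
    then have lk: "2 * k * k \<le> card L" and l2: "card L \<ge> N1" "card L \<ge> N2"
      unfolding N0_def by linarith+
    have "real (2 * k * k) \<le> ?l" using lk by (simp only: of_nat_le_iff)
    then have l1: "?l \<ge> 2 * real k * real k" by simp
    have "0 < 2 * k * k" using k by simp
    then have l0: "?l > 0" using lk by linarith
    show "(\<exists>A \<subseteq> V - (Y \<union> Z). balanced_clique k t E A) \<or>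
      (\<exists>B D. B \<subseteq> Y \<and> balanced_clique k ?T E B \<and> tiled (balanced_clique k ?T E) (Y - B) \<and>
         D \<subseteq> B \<union> (V - (Y \<union> Z)) \<and> tiled (balanced_clique k t E) D \<and> card D = ?M + k * t)"
    proof (cases "card {xs\<in>tuples k L. set xs \<in> E} \<ge> \<alpha> / 16 * ?l ^ k")
      case True
      from N1[OF finL l2(1) True] obtain As where As: "length As = k"
        "\<forall>i<k. finite (As ! i) \<and> card (As ! i) = t" "\<Union>(set As) \<subseteq> L" "\<forall>xs\<in>listset As. set xs \<in> E"
        by blast
      have "\<forall>A\<in>set As. finite A \<and> card A = t" using As(1,2) by (simp add: all_set_conv_all_nth)
      then have "balanced_clique k t E (\<Union>(set As))"
        unfolding balanced_clique_def complete_parts_def using As by blast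
      then show ?thesis using As(3) unfolding L_def by blast
    next
      case False
      define D where "D = {xs\<in>tuples (k - 1) L. distinct xs}"
      define e where "e v xs \<longleftrightarrow> insert v (set xs) \<in> E" for v :: 'v and xs
      define g where "g v = real (card {xs\<in>D. e v xs})" for v
      have finD: "finite D" using finL by (simp add: D_def)
      have D: "card D \<ge> 1/2 * ?l ^ (k - 1)"
      proof -
        have "(1 - (k - 1) * (k - 1) / card L) * ?l ^ (k - 1) \<le> card D"
          using card_clean_tuples[OF finL, of "{}" "k - 1"] by (simp add: D_def)
        moreover have "1/2 \<le> 1 - real ((k - 1) * (k - 1)) / card L"
        proof -
          have "real (k - 1) * real (k - 1) \<le> real k * real k" by (intro mult_mono) auto
          then have "real (k - 1) * real (k - 1) \<le> ?l / 2" using l1 by linarith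
          then have "real (k - 1) * real (k - 1) / ?l \<le> 1 / 2" using l0 by (simp add: divide_le_eq)
          then show ?thesis by simp
        qed
        then have "1/2 * ?l ^ (k - 1) \<le> (1 - real ((k - 1) * (k - 1)) / card L) * ?l ^ (k - 1)"
          by (intro mult_right_mono) auto
        ultimately show ?thesis by linarith
      qed
      moreover have "0 < 1/2 * ?l ^ (k - 1)" using l0 by simp
      ultimately have D0: "real (card D) > 0" by linarith
      have gsum: "sum g X = (\<Sum>xs\<in>D. real (card {v\<in>X. e v xs}))" if "finite X" for X
        unfolding g_def using that finD by (simp add: real_card_filter) (rule sum.swap)
      have "(\<Sum>xs\<in>D. (1/2 + \<alpha>) * ?n) \<le> (\<Sum>xs\<in>D. real (card {v\<in>V. e v xs}))"
      proof (rule sum_mono)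
        fix xs assume "xs \<in> D"
        then have "set xs \<subseteq> V" "card (set xs) = k - 1"
          by (auto simp: D_def tuples_def L_def distinct_card)
        then show "(1/2 + \<alpha>) * ?n \<le> real (card {v\<in>V. e v xs})"
          unfolding e_def by (rule deg)
      qed
      then have gV: "card D * ((1/2 + \<alpha>) * ?n) \<le> sum g V"
        using gsum[OF fin] by simp
      have gL: "sum g L \<le> \<alpha> / 8 * ?n * card D"
      proof -
        have "sum g L \<le> (\<Sum>xs\<in>tuples (k - 1) L. real (card {v\<in>L. e v xs}))"
          unfolding gsum[OF finL] using finL by (intro sum_mono2) (auto simp: D_def)
        also have "\<dots> = card {xs\<in>tuples (Suc (k - 1)) L. set xs \<in> E}"
          using finL by (simp add: card_tuples_Suc e_def)
        also have "\<dots> \<le> \<alpha> / 16 * ?l ^ k" using False k by simp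
        also have "\<dots> = \<alpha> / 16 * ?l * ?l ^ (k - 1)"
          using k by (cases k) auto
        also have "\<dots> \<le> \<alpha> / 16 * ?n * (2 * card D)"
        proof (intro mult_mono)
          show "?l \<le> ?n" using fin by (simp add: L_def card_mono)
        qed (use D \<alpha> in auto)
        finally show ?thesis by simp
      qed
      have gZ: "sum g Z \<le> \<alpha> / 4 * ?n * card D"
      proof -
        have "sum g Z \<le> (\<Sum>v\<in>Z. real (card D))"
          unfolding g_def using finD by (intro sum_mono) (auto intro: card_mono)
        also have "\<dots> = card Z * real (card D)" by simp
        also have "\<dots> \<le> \<alpha> / 4 * ?n * card D"
          by (rule mult_right_mono[OF Zs]) simp
        finally show ?thesis .
      qed
      have "V = Y \<union> Z \<union> L" using YZ by (auto simp: L_def)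
      moreover have "sum g (Y \<union> Z \<union> L) = sum g (Y \<union> Z) + sum g L"
        using finL finY finZ by (intro sum.union_disjoint) (auto simp: L_def)
      moreover have "sum g (Y \<union> Z) = sum g Y + sum g Z"
        using finY finZ YZ by (intro sum.union_disjoint)
      ultimately have "sum g V = sum g Y + sum g Z + sum g L" by simp
      then have "sum g Y \<ge> card D * ((1/2 + \<alpha>) * ?n) - \<alpha> / 8 * ?n * card D - \<alpha> / 4 * ?n * card D"
        using gV gL gZ by linarith
      then have "sum g Y \<ge> (1/2 + \<alpha> / 4) * card D * ?n + 3 / 8 * \<alpha> * (card D * ?n)"
        by (simp add: algebra_simps)
      moreover have "3 / 8 * \<alpha> * (card D * ?n) > 0" using \<alpha> D0 n by simp
      moreover have "(1/2 + \<alpha> / 4) * card D * card Y \<le> (1/2 + \<alpha> / 4) * card D * ?n"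
        using \<alpha> YZ fin by (intro mult_left_mono) (auto intro: card_mono)
      ultimately have "sum g Y > (1/2 + \<alpha> / 4) * card D * card Y" by linarith
      then obtain B where B: "balanced_clique k ?T E B" "B \<subseteq> Y" "tiled (balanced_clique k ?T E) (Y - B)"
        "sum g B > (1/2 + \<alpha> / 4) * card D * card B"
        using tiled_average[OF Y, of "(1/2 + \<alpha> / 4) * real (card D)" g] balanced_clique_card[OF uni] by blast
      have Bc: "finite B" "card B = ?M" using balanced_clique_card[OF uni B(1)] by auto
      have "?M > 0" using k t by simp
      then have "B \<noteq> {}" using Bc by auto
      then have "\<exists>W\<subseteq>B. card B \<le> 2 * card W \<and>
        \<alpha> / 4 * card D / 2 ^ card B \<le> card {xs\<in>D. \<forall>w\<in>W. e w xs}"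
        using B(4) \<alpha> unfolding g_def by (intro common_neighbourhood finD Bc(1)) simp_all
      then obtain W where W: "W \<subseteq> B" "card B \<le> 2 * card W"
        "\<alpha> / 4 * card D / 2 ^ card B \<le> card {xs\<in>D. \<forall>w\<in>W. e w xs}"
        by blast
      have "d2 * ?l ^ (k - 1) = \<alpha> / 4 / 2 ^ ?M * (1/2 * ?l ^ (k - 1))"
        by (simp add: d2_def)
      also have "\<dots> \<le> \<alpha> / 4 / 2 ^ ?M * card D"
        using D \<alpha> by (intro mult_left_mono) auto
      also have "\<dots> \<le> card {xs\<in>D. \<forall>w\<in>W. e w xs}" using W(3) Bc by simp
      also have "\<dots> \<le> card {xs\<in>tuples (k - 1) L. \<forall>w\<in>W. e w xs}"
        using finL by (intro of_nat_mono card_mono) (auto simp: D_def)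
      finally have "d2 * ?l ^ (k - 1) \<le> card {xs\<in>tuples (k - 1) L. \<forall>w\<in>W. e w xs}" by simp
      from N2[OF finL l2(2) this] obtain Ds where Ds: "length Ds = k - 1"
        "\<forall>i<k - 1. finite (Ds ! i) \<and> card (Ds ! i) = 2 * t" "\<Union>(set Ds) \<subseteq> L"
        "\<forall>xs\<in>listset Ds. \<forall>w\<in>W. e w xs" by blast
      have Ds2: "\<forall>D\<in>set Ds. finite D \<and> card D = 2 * t"
        using Ds(1,2) by (simp add: all_set_conv_all_nth)
      obtain As where As: "length As = k" "\<forall>A\<in>set As. finite A \<and> card A = ?T" "complete_parts E As"
        "B = \<Union>(set As)" using B(1) unfolding balanced_clique_def by blast
      have "\<exists>D. D \<subseteq> \<Union>(set As) \<union> L \<and> tiled (balanced_clique k t E) D \<and> card D = ?M + k * t"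
      proof (rule exchange[OF k uni t As(1-3) Ds(1) Ds2 Ds(3)])
        show "L \<inter> \<Union>(set As) = {}" using B(2) unfolding As(4)[symmetric] L_def by blast
        show "W \<subseteq> \<Union>(set As)" "?M \<le> 2 * card W" using W As Bc by simp_all
        show "insert w (set xs) \<in> E" if "w \<in> W" "xs \<in> listset Ds" for w xs
          using Ds(4) that by (simp add: e_def)
      qed
      then show ?thesis using B(1-3) unfolding L_def As(4)[symmetric] by blast
    qed
  qed
qed

text \<open>Every class size t is included because the improvement step for t starts from a tiling with
  the larger class size 2(k-1)t.\<close>

definition tiling_fraction :: "'v itself \<Rightarrow> nat \<Rightarrow> real \<Rightarrow> real \<Rightarrow> bool" where
  "tiling_fraction _ k \<alpha> c \<longleftrightarrow> (\<forall>t>0. \<exists>N. \<forall>(V :: 'v set) E.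
     half_codegree k E \<alpha> V \<longrightarrow> card V \<ge> N \<longrightarrow>
     (\<exists>X\<subseteq>V. tiled (balanced_clique k t E) X \<and> c * card V \<le> card X))"

text \<open>Start from a tiling by cliques of class size q t, with q = 2(k-1), and apply
  \<open>augmentation\<close> until either only a fraction \<open>\<epsilon>\<close> of V is
  uncovered or the small cliques cover the fraction \<open>\<alpha>/4\<close>. An exchange
  turns k q t covered vertices into k (q+1) t, all in small cliques, so at least the fraction
  1/(q+1) of the vertices in small cliques is gained. The iteration is expressed by a pair (Y,
  Z) with this invariant for which |Z| is maximal.\<close>

lemma tiling_fraction_step:
  fixes \<alpha> \<epsilon> c :: real
  assumes k: "k \<ge> 3" and \<alpha>: "\<alpha> > 0" and \<epsilon>: "\<epsilon> > 0"
    and c: "tiling_fraction TYPE('v) k \<alpha> c"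
  shows "tiling_fraction TYPE('v) k \<alpha> (min (c + \<alpha> / (4 * (2 * (k - 1) + 1))) (1 - \<epsilon>))"
  unfolding tiling_fraction_def
proof (intro allI impI)
  fix t :: nat assume t: "t > 0"
  define q where "q = 2 * (k - 1)"
  define c' where "c' = min (c + \<alpha> / (4 * (q + 1))) (1 - \<epsilon>)"
  have "q * t > 0" using k t by (simp add: q_def)
  then obtain N1 where N1: "\<And>(V :: 'v set) E. half_codegree k E \<alpha> V \<Longrightarrow> card V \<ge> N1 \<Longrightarrow>
     \<exists>X\<subseteq>V. tiled (balanced_clique k (q * t) E) X \<and> c * card V \<le> card X"
    using c unfolding tiling_fraction_def by blast
  obtain N2 where N2: "\<And>(V :: 'v set) E Y Z. half_codegree k E \<alpha> V \<Longrightarrow> card V \<ge> N2 \<Longrightarrow>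
    tiled (balanced_clique k (q * t) E) Y \<Longrightarrow> Y \<union> Z \<subseteq> V \<Longrightarrow> Y \<inter> Z = {} \<Longrightarrow>
    card Z \<le> \<alpha> / 4 * card V \<Longrightarrow> \<epsilon> * card V \<le> card (V - (Y \<union> Z)) \<Longrightarrow>
    (\<exists>A \<subseteq> V - (Y \<union> Z). balanced_clique k t E A) \<or>
    (\<exists>B D. B \<subseteq> Y \<and> balanced_clique k (q * t) E B \<and>
       tiled (balanced_clique k (q * t) E) (Y - B) \<and>
       D \<subseteq> B \<union> (V - (Y \<union> Z)) \<and> tiled (balanced_clique k t E) D \<and>
       card D = k * (q * t) + k * t)"
    using augmentation[OF k t \<alpha> \<epsilon>, where 'v = 'v] unfolding q_def by metis
  have "\<exists>X\<subseteq>V. tiled (balanced_clique k t E) X \<and> c' * card V \<le> card X"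
    if hc: "half_codegree k E \<alpha> V" and n: "max N1 N2 \<le> card V" for V :: "'v set" and E
  proof -
    let ?n = "real (card V)"
    have fin: "finite V" and uni: "\<forall>e\<in>E. card e = k"
      using hc unfolding half_codegree_def by auto
    \<comment> \<open>the invariant: one in q+1 of the vertices in small cliques is a gain\<close>
    define ok where "ok p \<longleftrightarrow> tiled (balanced_clique k (q * t) E) (fst p) \<and>
      tiled (balanced_clique k t E) (snd p) \<and> fst p \<union> snd p \<subseteq> V \<and> fst p \<inter> snd p = {} \<and>
      c * ?n + card (snd p) / (q + 1) \<le> card (fst p) + card (snd p)" for p
    obtain X0 where "X0 \<subseteq> V" "tiled (balanced_clique k (q * t) E) X0" "c * ?n \<le> card X0"
      using N1[OF hc] n by auto
    then have "ok (X0, {})" by (simp add: ok_def)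
    moreover have "\<forall>p. ok p \<longrightarrow> card (snd p) < Suc (card V)"
      using fin by (auto simp: ok_def less_Suc_eq_le intro: card_mono)
    ultimately have "\<exists>p. ok p \<and> (\<forall>p'. ok p' \<longrightarrow> card (snd p') \<le> card (snd p))"
      by (rule ex_has_greatest_nat[where f = "\<lambda>p. card (snd p)"])
    then obtain p where "ok p" and pmax: "\<And>p'. ok p' \<Longrightarrow> card (snd p') \<le> card (snd p)"
      by auto
    obtain Y Z where p: "p = (Y, Z)" by (rule prod.exhaust)
    have Y: "tiled (balanced_clique k (q * t) E) Y" and Z: "tiled (balanced_clique k t E) Z"
      and YZ: "Y \<union> Z \<subseteq> V" "Y \<inter> Z = {}" and cov: "c * ?n + card Z / (q + 1) \<le> card Y + card Z"
      using \<open>ok p\<close> unfolding p ok_def by simp_all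
    have Zmax: "card Z' \<le> card Z" if "ok (Y', Z')" for Y' Z'
      using pmax[OF that] by (simp add: p)
    have finY: "finite Y" "finite Z" using YZ fin by (auto intro: finite_subset)
    have cYZ: "card (Y \<union> Z) = card Y + card Z" using finY YZ by (simp add: card_Un_disjoint)
    have tYZ: "tiled (balanced_clique k t E) (Y \<union> Z)"
      using balanced_clique_split[OF uni t] by (intro tiled_Un tiled_trans[OF Y] Z YZ)
    have "c' * ?n \<le> card (Y \<union> Z)"
    proof (rule ccontr)
      assume small: "\<not> c' * ?n \<le> card (Y \<union> Z)"
      have Zs: "card Z \<le> \<alpha> / 4 * ?n"
      proof (rule ccontr)
        assume "\<not> card Z \<le> \<alpha> / 4 * ?n"
        then have "\<alpha> / 4 * ?n / (q + 1) \<le> card Z / (q + 1)" by (intro divide_right_mono) auto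
        then have "c * ?n + \<alpha> / 4 * ?n / (q + 1) \<le> card (Y \<union> Z)"
          using cov cYZ by linarith
        moreover have "(c + \<alpha> / (4 * (q + 1))) * ?n = c * ?n + \<alpha> / 4 * ?n / (q + 1)"
          by (simp add: distrib_right)
        moreover have "c' * ?n \<le> (c + \<alpha> / (4 * (q + 1))) * ?n"
          unfolding c'_def by (intro mult_right_mono) auto
        ultimately show False using small by linarith
      qed
      have Ls: "\<epsilon> * ?n \<le> card (V - (Y \<union> Z))"
      proof -
        have "c' * ?n \<le> (1 - \<epsilon>) * ?n" unfolding c'_def by (intro mult_right_mono) auto
        then have "card (Y \<union> Z) < (1 - \<epsilon>) * ?n" using small by linarith
        moreover have "card (V - (Y \<union> Z)) = card V - card (Y \<union> Z)"
          using YZ finY by (intro card_Diff_subset) auto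
        moreover have "card (Y \<union> Z) \<le> card V" using YZ fin by (intro card_mono)
        ultimately show ?thesis by (simp add: algebra_simps of_nat_diff)
      qed
      have kt: "k * t > 0" using k t by simp
      from N2[OF hc _ Y YZ Zs Ls] n
      have "(\<exists>A \<subseteq> V - (Y \<union> Z). balanced_clique k t E A) \<or>
        (\<exists>B D. B \<subseteq> Y \<and> balanced_clique k (q * t) E B \<and>
          tiled (balanced_clique k (q * t) E) (Y - B) \<and>
          D \<subseteq> B \<union> (V - (Y \<union> Z)) \<and> tiled (balanced_clique k t E) D \<and>
          card D = k * (q * t) + k * t)" by simp
      then consider A where "A \<subseteq> V - (Y \<union> Z)" "balanced_clique k t E A"
        | B D where "B \<subseteq> Y" "balanced_clique k (q * t) E B"
           "tiled (balanced_clique k (q * t) E) (Y - B)"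
           "D \<subseteq> B \<union> (V - (Y \<union> Z))" "tiled (balanced_clique k t E) D"
           "card D = k * (q * t) + k * t"
        by blast
      then show False
      proof cases
        case 1
        have A: "finite A" "card A = k * t" using balanced_clique_card[OF uni 1(2)] by auto
        have AZ: "A \<inter> Z = {}" "Y \<inter> (A \<union> Z) = {}" "Y \<union> (A \<union> Z) \<subseteq> V" using 1 YZ by blast+
        then have cA: "card (A \<union> Z) = k * t + card Z" using A finY by (simp add: card_Un_disjoint)
        have "ok (Y, A \<union> Z)"
          unfolding ok_def fst_conv snd_conv
        proof (intro conjI)
          show "tiled (balanced_clique k t E) (A \<union> Z)"
            by (rule tiled_insert[OF 1(2) AZ(1) Z])
          have "real (k * t) / (q + 1) \<le> real (k * t) / 1"
            by (intro divide_left_mono) auto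
          then show "c * ?n + card (A \<union> Z) / (q + 1) \<le> card Y + card (A \<union> Z)"
            using cov by (simp add: cA add_divide_distrib)
        qed (use Y AZ in auto)
        then have "card (A \<union> Z) \<le> card Z" by (rule Zmax)
        then show False using cA kt by linarith
      next
        case 2
        have B: "finite B" "card B = k * (q * t)" using balanced_clique_card[OF uni 2(2)] by auto
        have D: "finite D" using tiled_card[OF 2(5), of "k * t"] balanced_clique_card[OF uni] by blast
        have DZ: "D \<inter> Z = {}" "(Y - B) \<union> (D \<union> Z) \<subseteq> V" using 2(1,4) YZ by blast+
        have "D \<inter> (Y - B) = {}" using 2(4) by blast
        then have DY: "(Y - B) \<inter> (D \<union> Z) = {}" using YZ by blast
        have cD: "card (D \<union> Z) = k * (q * t) + k * t + card Z"
          using D finY 2(6) DZ by (simp add: card_Un_disjoint)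
        have "card (Y - B) = card Y - card B" "card B \<le> card Y"
          by (rule card_Diff_subset[OF B(1) 2(1)], rule card_mono[OF finY(1) 2(1)])
        then have cB: "card (Y - B) + k * (q * t) = card Y" using B by simp
        have "ok (Y - B, D \<union> Z)"
          unfolding ok_def fst_conv snd_conv
        proof (intro conjI)
          show "tiled (balanced_clique k t E) (D \<union> Z)"
            by (rule tiled_Un[OF 2(5) Z DZ(1)])
          have "card (D \<union> Z) = (k * t) * (q + 1) + card Z" unfolding cD by (simp add: algebra_simps)
          then have "real (card (D \<union> Z)) / real (q + 1) = real (k * t) + card Z / real (q + 1)"
            by (simp only: of_nat_add[of _ "card Z"] of_nat_mult[of "k * t"] add_divide_distrib) simp
          then show "c * ?n + card (D \<union> Z) / (q + 1) \<le> card (Y - B) + card (D \<union> Z)"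
            using cov cB cD by linarith
        qed (use 2(3) DZ DY in auto)
        then have "card (D \<union> Z) \<le> card Z" by (rule Zmax)
        then show False using cD kt by linarith
      qed
    qed
    then show ?thesis
      using tYZ YZ by blast
  qed
  then show "\<exists>N. \<forall>(V :: 'v set) E. half_codegree k E \<alpha> V \<longrightarrow> card V \<ge> N \<longrightarrow>
     (\<exists>X\<subseteq>V. tiled (balanced_clique k t E) X \<and>
       min (c + \<alpha> / (4 * (2 * (k - 1) + 1))) (1 - \<epsilon>) * card V \<le> card X)"
    unfolding c'_def q_def by blast
qed

text \<open>Each round gains the constant d, which is independent of the class size, so 1/d rounds
  suffice.\<close>

lemma almost_perfect_tiling:
  fixes \<alpha> \<epsilon> :: real
  assumes k: "k \<ge> 3" and \<alpha>: "\<alpha> > 0" and \<epsilon>: "0 < \<epsilon>" and t: "t > 0"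
  shows "\<exists>N. \<forall>(V :: 'v set) E. half_codegree k E \<alpha> V \<longrightarrow> card V \<ge> N \<longrightarrow>
     (\<exists>X\<subseteq>V. tiled (balanced_clique k t E) X \<and> (1 - \<epsilon>) * card V \<le> card X)"
proof -
  define d where "d = \<alpha> / (4 * (2 * (k - 1) + 1))"
  have d: "d > 0" using \<alpha> by (simp add: d_def)
  have *: "tiling_fraction TYPE('v) k \<alpha> (min (j * d) (1 - \<epsilon>))" for j :: nat
  proof (induction j)
    case 0
    have "\<exists>X\<subseteq>V. tiled (balanced_clique k t E) X \<and> min (real 0 * d) (1 - \<epsilon>) * card V \<le> card X"
      for V :: "'v set" and E t
    proof (intro exI[of _ "{}"] conjI)
      have "min (real 0 * d) (1 - \<epsilon>) * card V \<le> 0" by (intro mult_nonpos_nonneg) auto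
      then show "min (real 0 * d) (1 - \<epsilon>) * card V \<le> card ({} :: 'v set)" by simp
    qed auto
    then show ?case unfolding tiling_fraction_def by blast
  next
    case (Suc j)
    have "min (min (j * d) (1 - \<epsilon>) + d) (1 - \<epsilon>) = min (Suc j * d) (1 - \<epsilon>)"
      using d by (auto simp: min_def algebra_simps)
    then show ?case using tiling_fraction_step[OF k \<alpha> \<epsilon> Suc] unfolding d_def by simp
  qed
  obtain j :: nat where "1 < j * d" using d reals_Archimedean3 by blast
  then have "min (j * d) (1 - \<epsilon>) = 1 - \<epsilon>" using \<epsilon> by simp
  with *[of j] have "tiling_fraction TYPE('v) k \<alpha> (1 - \<epsilon>)" by simp
  then show ?thesis using t unfolding tiling_fraction_def by blast
qed

section \<open>Absorbers\<close>

lemma clean_tuples_half: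
  assumes "finite V" "F \<subseteq> V" "2 * m * (card F + m) \<le> card V" "V \<noteq> {}"
  shows "real (card {xs\<in>tuples m V. distinct xs \<and> set xs \<inter> F = {}}) \<ge> 1/2 * real (card V) ^ m"
proof -
  have n: "real (card V) > 0" using assms by (simp add: card_gt_0_iff)
  have "real (2 * m * (card F + m)) \<le> card V" using assms(3) by (simp only: of_nat_le_iff)
  then have "real (m * (card F + m)) / card V \<le> 1/2" using n by (simp add: divide_le_eq)
  then have "1/2 * real (card V) ^ m \<le> (1 - real (m * (card F + m)) / card V) * real (card V) ^ m"
    by (intro mult_right_mono) auto
  then show ?thesis using card_clean_tuples[OF assms(1,2), of m] by linarith
qed

lemma edge_density:
  assumes hc: "half_codegree k E \<alpha> V" and k: "k \<ge> 1" and \<alpha>: "\<alpha> \<ge> 0"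
    and n: "2 * k * k \<le> card V" 
  shows "1/4 * real (card V) ^ k \<le> card {xs\<in>tuples k V. set xs \<in> E}"
proof -
  note h = half_codegreeD[OF hc]
  let ?n = "real (card V)"
  let ?D = "{xs\<in>tuples (k - 1) V. distinct xs \<and> set xs \<inter> {} = {}}"
  have "V \<noteq> {}" using n k by auto
  have "2 * (k - 1) * (card ({} :: 'a set) + (k - 1)) \<le> 2 * k * k" by (intro mult_mono) auto
  then have D: "1/2 * ?n ^ (k - 1) \<le> card ?D"
    using h(1) n \<open>V \<noteq> {}\<close> by (intro clean_tuples_half) auto
  have "1/4 * ?n ^ k = 1/2 * ?n ^ (k - 1) * (1/2 * ?n)" using k by (cases k) auto
  also have "\<dots> \<le> card ?D * (1/2 * ?n)" using D by (intro mult_right_mono) auto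
  also have "\<dots> = (\<Sum>xs\<in>?D. 1/2 * ?n)" by simp
  also have "\<dots> \<le> (\<Sum>xs\<in>?D. real (card {v\<in>V. insert v (set xs) \<in> E}))"
  proof (rule sum_mono)
    fix xs assume "xs \<in> ?D"
    then have "set xs \<subseteq> V" "card (set xs) = k - 1" by (auto simp: tuples_def distinct_card)
    then have "(1/2 + \<alpha>) * ?n \<le> card {v\<in>V. insert v (set xs) \<in> E}" by (rule h(3))
    moreover have "1/2 * ?n \<le> (1/2 + \<alpha>) * ?n" using \<alpha> by (intro mult_right_mono) auto
    ultimately show "1/2 * ?n \<le> card {v\<in>V. insert v (set xs) \<in> E}" by linarith
  qed
  also have "\<dots> \<le> (\<Sum>xs\<in>tuples (k - 1) V. real (card {v\<in>V. insert v (set xs) \<in> E}))"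
    using h(1) by (intro sum_mono2) auto
  also have "\<dots> = card {xs\<in>tuples (Suc (k - 1)) V. set xs \<in> E}"
    using h(1) by (simp add: card_tuples_Suc)
  finally show ?thesis using k by simp
qed

text \<open>For a (k-2)-set that avoids x and y, its unions with x and with y each have at least (1/2 +
  \<open>\<alpha>\<close>) |V| neighbours, hence at least 2 \<open>\<alpha>\<close> |V| common
  ones.\<close>

lemma common_link_density:
  assumes hc: "half_codegree k E \<alpha> V" and k: "k \<ge> 2" and \<alpha>: "\<alpha> > 0"
    and n: "2 * k * k \<le> card V" and xy: "x \<in> V" "y \<in> V"
  shows "\<alpha> * real (card V) ^ (k - 1)
    \<le> card {xs\<in>tuples (k - 1) V. insert x (set xs) \<in> E \<and> insert y (set xs) \<in> E}"
proof -
  note h = half_codegreeD[OF hc]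
  let ?n = "real (card V)"
  let ?D = "{xs\<in>tuples (k - 2) V. distinct xs \<and> set xs \<inter> {x, y} = {}}"
  let ?P = "\<lambda>xs z. insert x (insert z (set xs)) \<in> E \<and> insert y (insert z (set xs)) \<in> E"
  have "V \<noteq> {}" using xy by auto
  have "2 * (k - 2) * (card {x, y} + (k - 2)) \<le> 2 * k * k"
    using k by (intro mult_mono) (auto simp: card_insert_if)
  then have D: "1/2 * ?n ^ (k - 2) \<le> card ?D"
    using h(1) n \<open>V \<noteq> {}\<close> xy by (intro clean_tuples_half) auto
  have "?n ^ (k - 1) = ?n ^ (k - 2) * ?n"
    using k by (metis Suc_diff_le diff_Suc_Suc numeral_2_eq_2 One_nat_def power_Suc2)
  then have "\<alpha> * ?n ^ (k - 1) = 1/2 * ?n ^ (k - 2) * (2 * \<alpha> * ?n)" by simp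
  also have "\<dots> \<le> card ?D * (2 * \<alpha> * ?n)" using D \<alpha> by (intro mult_right_mono) auto
  also have "\<dots> = (\<Sum>xs\<in>?D. 2 * \<alpha> * ?n)" by simp
  also have "\<dots> \<le> (\<Sum>xs\<in>?D. real (card {z\<in>V. ?P xs z}))"
  proof (rule sum_mono)
    fix xs assume "xs \<in> ?D"
    then have xs: "set xs \<subseteq> V" "card (set xs) = k - 2" "x \<notin> set xs" "y \<notin> set xs"
      by (auto simp: tuples_def distinct_card)
    let ?N = "\<lambda>u. {z\<in>V. insert z (insert u (set xs)) \<in> E}"
    have N: "(1/2 + \<alpha>) * ?n \<le> card (?N u)" if "u \<in> V" "u \<notin> set xs" for u
      using that xs k by (intro h(3)) auto
    have fN: "finite (?N x)" "finite (?N y)" using h(1) by auto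
    have "card (?N x) + card (?N y) = card (?N x \<union> ?N y) + card (?N x \<inter> ?N y)"
      by (rule card_Un_Int[OF fN])
    moreover have "card (?N x \<union> ?N y) \<le> card V" using h(1) by (intro card_mono) auto
    ultimately have "real (card (?N x)) + card (?N y) \<le> ?n + card (?N x \<inter> ?N y)" by linarith
    moreover have "?N x \<inter> ?N y = {z\<in>V. ?P xs z}" by (auto simp: insert_commute)
    ultimately show "2 * \<alpha> * ?n \<le> card {z\<in>V. ?P xs z}"
      using N[OF xy(1) xs(3)] N[OF xy(2) xs(4)] by (simp add: algebra_simps)
  qed
  also have "\<dots> \<le> (\<Sum>xs\<in>tuples (k - 2) V. real (card {z\<in>V. ?P xs z}))"
    using h(1) by (intro sum_mono2) auto
  also have "\<dots> = card {xs\<in>tuples (Suc (k - 2)) V. insert x (set xs) \<in> E \<and> insert y (set xs) \<in> E}"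
    using h(1) by (simp add: card_tuples_Suc)
  also have "Suc (k - 2) = k - 1" using k by simp
  finally show ?thesis .
qed

text \<open>Tuples that form a balanced clique of class size b with x as well as with y. They allow x to
  be exchanged for y.\<close>

definition connectors :: "nat \<Rightarrow> nat \<Rightarrow> 'v set set \<Rightarrow> 'v set \<Rightarrow> 'v \<Rightarrow> 'v \<Rightarrow> 'v list set" where
  "connectors k b E V x y = {S\<in>tuples (k * b - 1) V.
     balanced_clique k b E (insert x (set S)) \<and> balanced_clique k b E (insert y (set S))}"

text \<open>Consider the k-tuples v # ws that are edges, with ws in the common link of x and y and v
  different from both. This relation is dense. In a blow-up with class sizes b - 1, b, ..., b,
  both x and y can be added to the first class, which is nonempty as b is at least 2.\<close>

lemma many_connectors:
  fixes \<alpha> :: real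
  assumes k: "k \<ge> 2" and b: "b \<ge> 2" and \<alpha>: "\<alpha> > 0"
  shows "\<exists>c>0. \<exists>N. \<forall>(V :: 'v set) E. half_codegree k E \<alpha> V \<longrightarrow> card V \<ge> N \<longrightarrow>
    (\<forall>x\<in>V. \<forall>y\<in>V. c * real (card V) ^ (k * b - 1) \<le> card (connectors k b E V x y))"
proof -
  define ts where "ts = (b - 1) # replicate (k - 1) b"
  define d where "d = \<alpha> / 2"
  have d: "d > 0" using \<alpha> by (simp add: d_def)
  have lts: "length ts = k" using k by (simp add: ts_def)
  have sts: "sum_list ts = k * b - 1"
  proof -
    have "sum_list ts = (b - 1) + (k - 1) * b" by (simp add: ts_def sum_list_replicate)
    also have "\<dots> = Suc (k - 1) * b - 1" using b by simp
    finally show ?thesis using k by simp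
  qed
  obtain N where N: "\<And>(V :: 'v set) P. finite V \<Longrightarrow> card V \<ge> N \<Longrightarrow>
    card {xs\<in>tuples k V. P xs} \<ge> d * real (card V) ^ k \<Longrightarrow>
    card {yss\<in>blowups ts V. distinct (concat yss) \<and> (\<forall>xs\<in>listset (map set yss). P xs)}
      \<ge> d ^ prod_list ts / 2 * real (card V) ^ (k * b - 1)"
    using many_distinct_blowups[OF d, of ts, where 'v = 'v] unfolding lts sts by blast
  \<comment> \<open>for |V| at least 2/\<alpha>, the surplus \<alpha> |V| in the codegree makes up for
    the exclusion of x and y\<close>
  obtain N' :: nat where N': "2 / \<alpha> \<le> N'" using real_arch_simple by blast
  show ?thesis
  proof (intro exI[of _ "d ^ prod_list ts / 2"] exI[of _ "N + N' + 2 * k * k"] conjI allI impI ballI)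
    show "0 < d ^ prod_list ts / 2" using d by simp
    fix V :: "'v set" and E x y
    assume hc: "half_codegree k E \<alpha> V" and nN: "N + N' + 2 * k * k \<le> card V"
      and xy: "x \<in> V" "y \<in> V"
    note h = half_codegreeD[OF hc]
    let ?n = "real (card V)"
    define C where "C = {xs\<in>tuples (k - 1) V. insert x (set xs) \<in> E \<and> insert y (set xs) \<in> E}"
    define P where "P xs \<longleftrightarrow> set xs \<in> E \<and> insert x (set (tl xs)) \<in> E \<and> insert y (set (tl xs)) \<in> E
      \<and> hd xs \<noteq> x \<and> hd xs \<noteq> y" for xs
    have C: "\<alpha> * ?n ^ (k - 1) \<le> card C"
      unfolding C_def using nN by (intro common_link_density hc k \<alpha> xy) simp
    have "2 / \<alpha> \<le> ?n" using N' nN by linarith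
    then have n\<alpha>: "2 \<le> \<alpha> * ?n" using \<alpha> by (simp add: field_simps)
    have "d * ?n ^ k = \<alpha> * ?n ^ (k - 1) * (1/2 * ?n)" using k by (cases k) (auto simp: d_def)
    also have "\<dots> \<le> card C * (1/2 * ?n)" using C by (intro mult_right_mono) auto
    also have "\<dots> = (\<Sum>xs\<in>C. 1/2 * ?n)" by simp
    also have "\<dots> \<le> (\<Sum>xs\<in>C. real (card {v\<in>V. P (v # xs)}))"
    proof (rule sum_mono)
      fix xs assume "xs \<in> C"
      then have xs: "set xs \<subseteq> V" "length xs = k - 1" "insert x (set xs) \<in> E" "insert y (set xs) \<in> E"
        by (auto simp: C_def tuples_def)
      have "card (insert x (set xs)) = k" using xs(3) h(2) by blast
      moreover have "card (insert x (set xs)) \<le> Suc (card (set xs))" by (simp add: card_insert_if)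
      moreover have "card (set xs) \<le> k - 1" using card_length[of xs] xs(2) by simp
      ultimately have "card (set xs) = k - 1" by linarith
      then have "(1/2 + \<alpha>) * ?n \<le> card {v\<in>V. insert v (set xs) \<in> E}" by (rule h(3)[OF xs(1)])
      also have "card {v\<in>V. insert v (set xs) \<in> E} \<le> card ({v\<in>V. P (v # xs)} \<union> {x, y})"
        using h(1) xs by (intro card_mono) (auto simp: P_def)
      also have "\<dots> \<le> card {v\<in>V. P (v # xs)} + card {x, y}" by (rule card_Un_le)
      also have "card {x, y} \<le> 2" by (simp add: card_insert_if)
      finally have "(1/2 + \<alpha>) * ?n \<le> real (card {v\<in>V. P (v # xs)}) + 2" by simp
      then show "1/2 * ?n \<le> real (card {v\<in>V. P (v # xs)})" using n\<alpha> by (simp add: algebra_simps)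
    qed
    also have "\<dots> \<le> (\<Sum>xs\<in>tuples (k - 1) V. real (card {v\<in>V. P (v # xs)}))"
      using h(1) by (intro sum_mono2) (auto simp: C_def)
    also have "\<dots> = card {xs\<in>tuples (Suc (k - 1)) V. P xs}"
      using h(1) by (simp add: card_tuples_Suc)
    finally have "d * ?n ^ k \<le> card {xs\<in>tuples k V. P xs}" using k by simp
    from N[OF h(1) _ this] nN have "d ^ prod_list ts / 2 * ?n ^ (k * b - 1)
      \<le> card {yss\<in>blowups ts V. distinct (concat yss) \<and> (\<forall>xs\<in>listset (map set yss). P xs)}" by simp
    also have "\<dots> = card (concat ` {yss\<in>blowups ts V. distinct (concat yss) \<and> (\<forall>xs\<in>listset (map set yss). P xs)})"
    proof -
      have "inj_on concat {yss\<in>blowups ts V. distinct (concat yss) \<and> (\<forall>xs\<in>listset (map set yss). P xs)}"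
        by (rule inj_on_subset[OF inj_on_concat_blowups]) auto
      then show ?thesis by (simp add: card_image)
    qed
    also have "\<dots> \<le> card (connectors k b E V x y)"
    proof (intro of_nat_mono card_mono subsetI)
      show "finite (connectors k b E V x y)" using h(1) by (simp add: connectors_def)
      fix S assume "S \<in> concat ` {yss\<in>blowups ts V. distinct (concat yss) \<and> (\<forall>xs\<in>listset (map set yss). P xs)}"
      then obtain yss where yss: "yss \<in> blowups ts V" "distinct (concat yss)"
        "\<And>xs. xs \<in> listset (map set yss) \<Longrightarrow> P xs" "S = concat yss" by blast
      have "S \<in> tuples (k * b - 1) V" using concat_blowups[of ts V] yss sts by auto
      from yss(1) obtain ys zss where ys: "yss = ys # zss" "ys \<in> tuples (b - 1) V"
        by (auto simp: ts_def blowups_Cons)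
      have ml: "map length yss = ts" using blowups_lengths[OF yss(1)] .
      have "distinct ys" "length ys = b - 1" "distinct (concat zss)"
        using yss(2) ys by (auto simp: tuples_def)
      then have ysc: "card (set ys) = b - 1" by (simp add: distinct_card)
      have mlz: "map length zss = replicate (k - 1) b" using ml ys by (simp add: ts_def)
      then have lz: "length zss = k - 1" by (metis length_map length_replicate)
      have zb: "finite A \<and> card A = b" if "A \<in> set (map set zss)" for A
      proof -
        obtain zs where zs: "zs \<in> set zss" "A = set zs" using \<open>A \<in> set (map set zss)\<close> by auto
        have "length zs \<in> set (map length zss)" using zs(1) by simp
        then have "length zs = b" unfolding mlz by (simp add: set_replicate_conv_if split: if_splits)
        moreover have "distinct zs" using \<open>distinct (concat zss)\<close> zs(1) by (simp add: distinct_concat_iff)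
        ultimately show ?thesis using zs(2) by (simp add: distinct_card)
      qed
      have "ys \<noteq> []" using ysc b by auto
      then obtain v where v: "v \<in> set ys" by fastforce
      have zP: "P (u # ws)" if "u \<in> set ys" "ws \<in> listset (map set zss)" for u ws
        using yss(3)[of "u # ws"] that by (simp add: ys(1) Cons_in_listset del: listset.simps)
      have "\<exists>ws. ws \<in> listset (map set zss)"
      proof -
        have "map hd zss \<in> listset (map set zss)"
          unfolding listset_iff_nth
        proof (intro conjI allI impI)
          fix i assume i: "i < length (map set zss)"
          then have "card (map set zss ! i) = b" using zb by (metis nth_mem)
          then have "zss ! i \<noteq> []" using i b by auto
          then show "map hd zss ! i \<in> map set zss ! i" using i by simp
        qed simp
        then show ?thesis by blast
      qed
      then obtain ws0 where ws0: "ws0 \<in> listset (map set zss)" by blast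
      have clique: "balanced_clique k b E (insert w (set S))" if w: "w = x \<or> w = y" for w
        unfolding balanced_clique_def
      proof (intro exI conjI)
        let ?As = "insert w (set ys) # map set zss"
        show "length ?As = k" using lz k by simp
        have "w \<notin> set ys" using zP[OF _ ws0] w unfolding P_def by auto
        then have "card (insert w (set ys)) = b" using ysc b by simp
        then show "\<forall>A\<in>set ?As. finite A \<and> card A = b" using zb by simp
        show "complete_parts E ?As"
          unfolding complete_parts_def
        proof
          fix us assume "us \<in> listset ?As"
          then obtain u ws where us: "us = u # ws" "u \<in> insert w (set ys)" "ws \<in> listset (map set zss)"
            by (auto simp: set_Cons_def)
          show "set us \<in> E"
          proof (cases "u \<in> set ys")
            case True
            then show ?thesis using zP[OF True us(3)] us(1) by (simp add: P_def)
          next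
            case False
            then have "u = w" using us(2) by simp
            then show ?thesis using zP[OF v us(3)] us(1) w by (auto simp: P_def)
          qed
        qed
        show "insert w (set S) = \<Union>(set ?As)" using yss(4) ys(1) by auto
      qed
      show "S \<in> connectors k b E V x y"
        using clique[of x] clique[of y] \<open>S \<in> tuples (k * b - 1) V\<close> by (simp add: connectors_def)
    qed
    finally show "d ^ prod_list ts / 2 * ?n ^ (k * b - 1) \<le> card (connectors k b E V x y)"
      by simp
  qed
qed

text \<open>Blow-ups of edges with the sizes of the colour classes of K are spanned by copies of K.\<close>

lemma many_copies:
  fixes \<alpha> :: real
  assumes k: "k \<ge> 1" and \<alpha>: "\<alpha> \<ge> 0" and finK: "finite (verts K)"
    and col: "partite_colouring k K c" and ne: "edges K \<noteq> {}"
  shows "\<exists>d>0. \<exists>N. \<forall>(V :: 'v set) E. half_codegree k E \<alpha> V \<longrightarrow> card V \<ge> N \<longrightarrow>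
    d * real (card V) ^ card (verts K) \<le> card {ps\<in>tuples (card (verts K)) V. spans K E (set ps)}"
proof -
  define ts where "ts = map (\<lambda>i. card {v\<in>verts K. c v = i}) [0..<k]"
  have lts: "length ts = k" by (simp add: ts_def)
  have clt: "c v < k" if "v \<in> verts K" for v
    using col that by (auto simp: partite_colouring_def)
  have sts: "sum_list ts = card (verts K)"
  proof -
    have "sum_list ts = (\<Sum>i<k. card {v\<in>verts K. c v = i})"
      unfolding ts_def by (simp add: interv_sum_list_conv_sum_set_nat atLeast0LessThan)
    also have "\<dots> = card (\<Union>i<k. {v\<in>verts K. c v = i})"
      using finK by (subst card_UN_disjoint) auto
    also have "(\<Union>i<k. {v\<in>verts K. c v = i}) = verts K" using clt by auto
    finally show ?thesis .
  qed
  obtain N where N: "\<And>(V :: 'v set) P. finite V \<Longrightarrow> card V \<ge> N \<Longrightarrow>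
    card {xs\<in>tuples k V. P xs} \<ge> 1/4 * real (card V) ^ k \<Longrightarrow>
    card {yss\<in>blowups ts V. distinct (concat yss) \<and> (\<forall>xs\<in>listset (map set yss). P xs)}
      \<ge> (1/4) ^ prod_list ts / 2 * real (card V) ^ card (verts K)"
    using many_distinct_blowups[of "1/4" ts, where 'v = 'v] unfolding lts sts by auto
  show ?thesis
  proof (intro exI[of _ "(1/4) ^ prod_list ts / 2"] exI[of _ "N + 2 * k * k"] conjI allI impI)
    fix V :: "'v set" and E
    assume hc: "half_codegree k E \<alpha> V" and nN: "N + 2 * k * k \<le> card V"
    note h = half_codegreeD[OF hc]
    let ?Y = "{yss\<in>blowups ts V. distinct (concat yss) \<and> (\<forall>xs\<in>listset (map set yss). set xs \<in> E)}"
    have "1/4 * real (card V) ^ k \<le> card {xs\<in>tuples k V. set xs \<in> E}"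
      using nN by (intro edge_density[OF hc k \<alpha>]) simp
    from N[OF h(1) _ this] nN
    have "(1/4) ^ prod_list ts / 2 * real (card V) ^ card (verts K) \<le> card ?Y" by simp
    also have "\<dots> = card (concat ` ?Y)"
    proof -
      have "inj_on concat ?Y" by (rule inj_on_subset[OF inj_on_concat_blowups]) auto
      then show ?thesis by (simp add: card_image)
    qed
    also have "\<dots> \<le> card {ps\<in>tuples (card (verts K)) V. spans K E (set ps)}"
    proof (intro of_nat_mono card_mono subsetI)
      show "finite {ps\<in>tuples (card (verts K)) V. spans K E (set ps)}" using h(1) by simp
      fix ps assume "ps \<in> concat ` ?Y"
      then obtain yss where yss: "yss \<in> blowups ts V" "distinct (concat yss)"
        "\<forall>xs\<in>listset (map set yss). set xs \<in> E" "ps = concat yss" by blast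
      have "ps \<in> tuples (card (verts K)) V" using concat_blowups[of ts V] yss sts by auto
      moreover have "spans K E (\<Union>(set (map set yss)))"
      proof (rule spans_complete_parts[OF h(2) finK col ne])
        show "length (map set yss) = k" using blowup_parts(1)[OF yss(1,2)] lts by simp
        show "complete_parts E (map set yss)" using yss(3) by (simp add: complete_parts_def)
        show "finite (map set yss ! i) \<and> card (map set yss ! i) = card {v\<in>verts K. c v = i}"
          if "i < k" for i
          using blowup_parts(2)[OF yss(1,2), of i] that by (simp add: lts) (simp add: ts_def)
      qed
      ultimately show "ps \<in> {ps\<in>tuples (card (verts K)) V. spans K E (set ps)}"
        using yss(4) by simp
    qed
    finally show "(1/4) ^ prod_list ts / 2 * real (card V) ^ card (verts K)
      \<le> card {ps\<in>tuples (card (verts K)) V. spans K E (set ps)}" by simp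
  qed simp
qed

text \<open>Each piece consists of an entry of xs and the entries of the corresponding tuple of Ss;
  distinctness makes the pieces disjoint.\<close>

lemma tiled_attach:
  assumes "length xs = length Ss" "distinct (xs @ concat Ss)"
    "\<And>i. i < length xs \<Longrightarrow> tiled Q (insert (xs ! i) (set (Ss ! i)))"
  shows "tiled Q (set xs \<union> set (concat Ss))"
  using assms
proof (induction xs Ss rule: list_induct2)
  case (Cons x xs S Ss)
  have "tiled Q (set xs \<union> set (concat Ss))"
  proof (rule Cons.IH)
    show "distinct (xs @ concat Ss)" using Cons.prems(1) by auto
    show "tiled Q (insert (xs ! i) (set (Ss ! i)))" if "i < length xs" for i
      using Cons.prems(2)[of "Suc i"] that by simp
  qed
  moreover have "tiled Q (insert x (set S))" using Cons.prems(2)[of 0] by simp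
  moreover have "insert x (set S) \<inter> (set xs \<union> set (concat Ss)) = {}"
    using Cons.prems(1) by auto
  ultimately have "tiled Q (insert x (set S) \<union> (set xs \<union> set (concat Ss)))"
    by (intro tiled_Un[of Q "insert x (set S)"])
  moreover have "insert x (set S) \<union> (set xs \<union> set (concat Ss)) = set (x # xs) \<union> set (concat (S # Ss))"
    by auto
  ultimately show ?case by simp
qed simp

lemma card_listset_ge:
  fixes r :: real
  assumes "\<And>A. A \<in> set As \<Longrightarrow> finite A \<and> r \<le> card A" "r \<ge> 0"
  shows "finite (listset As) \<and> r ^ length As \<le> card (listset As)"
  using assms(1)
proof (induction As)
  case (Cons A As)
  have eq: "listset (A # As) = (\<lambda>(x, xs). x # xs) ` (A \<times> listset As)"
    by (auto simp: set_Cons_def image_iff)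
  have IH: "finite (listset As)" "r ^ length As \<le> card (listset As)" using Cons by auto
  have "card (listset (A # As)) = card A * card (listset As)"
    unfolding eq by (subst card_image) (auto simp: inj_on_def card_cartesian_product)
  moreover have "r * r ^ length As \<le> card A * real (card (listset As))"
    using Cons.prems IH assms(2) by (intro mult_mono) auto
  moreover have "finite (listset (A # As))" unfolding eq using Cons.prems IH by simp
  ultimately show ?case by simp
qed simp

definition absorbs :: "'a hypergraph \<Rightarrow> 'v set set \<Rightarrow> 'v set \<Rightarrow> 'v set \<Rightarrow> bool" where
  "absorbs K E A Q \<longleftrightarrow> tiled (spans K E) A \<and> tiled (spans K E) (A \<union> Q)"

text \<open>Fix an enumeration qs of Q. The tuples ps @ concat Ss, where ps lists a copy of K and the
  i-th entry of Ss connects the i-th entries of qs and ps, have positive density. Few of them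
  have repeated vertices or meet the forbidden set F. All others absorb Q: alone they are
  tiled by attaching the entries of ps to those of Ss, and together with Q by attaching qs to
  Ss, which leaves the copy of K on ps.\<close>

lemma many_absorbers:
  fixes \<alpha> :: real and K :: "'a hypergraph"
  assumes k: "k \<ge> 2" and \<alpha>: "\<alpha> > 0" and finK: "finite (verts K)"
    and col: "partite_colouring k K c" and ne: "edges K \<noteq> {}"
    and b: "card (verts K) = b" "b \<ge> 2"
  shows "\<exists>\<xi>>0. \<exists>\<sigma>>0. \<exists>N. \<forall>(V :: 'v set) E Q F. half_codegree k E \<alpha> V \<longrightarrow> card V \<ge> N \<longrightarrow>
    Q \<subseteq> F \<longrightarrow> card Q = b \<longrightarrow> F \<subseteq> V \<longrightarrow> real (card F) \<le> \<sigma> * real (card V) \<longrightarrow>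
    \<xi> * real (card V) ^ (k * b * b) \<le>
      card {zs\<in>tuples (k * b * b) V. set zs \<inter> F = {} \<and> absorbs K E (set zs) Q}"
proof -
  let ?m = "k * b * b"
  have k1: "k \<ge> 1" using k by simp
  have "\<exists>d>0. \<exists>N. \<forall>(V :: 'v set) E. half_codegree k E \<alpha> V \<longrightarrow> card V \<ge> N \<longrightarrow>
    d * real (card V) ^ b \<le> card {ps\<in>tuples b V. spans K E (set ps)}"
    by (rule many_copies[OF k1 less_imp_le[OF \<alpha>] finK col ne, unfolded b(1)])
  then obtain d N1 where d: "d > 0" and N1: "\<forall>(V :: 'v set) E. half_codegree k E \<alpha> V \<longrightarrow>
    card V \<ge> N1 \<longrightarrow> d * real (card V) ^ b \<le> card {ps\<in>tuples b V. spans K E (set ps)}"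
    by (elim exE conjE)
  obtain c1 N2 where c1: "c1 > 0" and N2: "\<forall>(V :: 'v set) E. half_codegree k E \<alpha> V \<longrightarrow>
    card V \<ge> N2 \<longrightarrow> (\<forall>x\<in>V. \<forall>y\<in>V.
    c1 * real (card V) ^ (k * b - 1) \<le> card (connectors k b E V x y))"
    using many_connectors[OF k b(2) \<alpha>, where 'v = 'v] by (elim exE conjE)
  define \<xi> where "\<xi> = d * c1 ^ b / 2"
  have \<xi>: "\<xi> > 0" using d c1 by (simp add: \<xi>_def)
  have m0: "?m > 0" using k b by simp
  \<comment> \<open>a proportion 2\<xi> of all tuples are candidates; excluded vertices and repetitions
    spoil at most \<xi>/2 each\<close>
  define \<sigma> where "\<sigma> = \<xi> / (2 * ?m)"
  have \<sigma>: "\<sigma> > 0" using \<xi> m0 unfolding \<sigma>_def by (intro divide_pos_pos) simp_all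
  obtain N3 :: nat where N3: "2 * real ?m * real ?m / \<xi> \<le> N3" using real_arch_simple by blast
  have main: "\<xi> * real (card V) ^ ?m \<le>
      card {zs\<in>tuples ?m V. set zs \<inter> F = {} \<and> absorbs K E (set zs) Q}"
    if hc: "half_codegree k E \<alpha> V" and nN: "Suc (N1 + N2 + N3) \<le> card V"
      and Q: "Q \<subseteq> F" "card Q = b" and F: "F \<subseteq> V" "real (card F) \<le> \<sigma> * real (card V)"
    for V :: "'v set" and E Q F
  proof -
    note h = half_codegreeD[OF hc]
    let ?n = "real (card V)"
    have n: "?n > 0" using nN by linarith
    have finF: "finite F" using F h(1) finite_subset by blast
    obtain qs where qs: "set qs = Q" "distinct qs"
      using finite_distinct_list[of Q] finF Q finite_subset by blast
    have lqs: "length qs = b" using qs Q distinct_card by fastforce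
    have qV: "qs ! i \<in> V" if "i < b" for i
      using that lqs qs(1) Q(1) F(1) by (metis nth_mem subsetD)
    let ?C = "connectors k b E V"
    define Ps where "Ps = {ps\<in>tuples b V. spans K E (set ps)}"
    define Cs where "Cs ps = listset (map (\<lambda>i. ?C (qs ! i) (ps ! i)) [0..<b])" for ps
    have Ps: "d * ?n ^ b \<le> card Ps" unfolding Ps_def using N1[rule_format, OF hc] nN by simp
    have finPs: "finite Ps" using h(1) by (simp add: Ps_def)
    have Cs: "finite (Cs ps) \<and> (c1 * ?n ^ (k * b - 1)) ^ b \<le> card (Cs ps)" if "ps \<in> Ps" for ps
    proof -
      have pV: "ps ! i \<in> V" if "i < b" for i
        using \<open>ps \<in> Ps\<close> that by (auto simp: Ps_def tuples_def)
      have "finite (Cs ps) \<and> (c1 * ?n ^ (k * b - 1)) ^ length (map (\<lambda>i. ?C (qs ! i) (ps ! i)) [0..<b]) \<le> card (Cs ps)"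
        unfolding Cs_def
      proof (rule card_listset_ge)
        fix A assume "A \<in> set (map (\<lambda>i. ?C (qs ! i) (ps ! i)) [0..<b])"
        then obtain i where i: "i < b" "A = ?C (qs ! i) (ps ! i)" by auto
        have "finite A" using h(1) i by (simp add: connectors_def)
        then show "finite A \<and> c1 * ?n ^ (k * b - 1) \<le> card A"
          using N2[rule_format, OF hc _ qV pV] i nN by simp
      qed (use c1 in simp)
      then show ?thesis by simp
    qed
    have CsB: "Cs ps \<subseteq> blowups (replicate b (k * b - 1)) V" for ps
    proof
      fix Ss assume "Ss \<in> Cs ps"
      then show "Ss \<in> blowups (replicate b (k * b - 1)) V"
        by (auto simp: Cs_def blowups_def listset_iff_nth connectors_def)
    qed
    define f where "f = (\<lambda>(ps :: 'v list, Ss). ps @ concat Ss)"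
    define A where "A = f ` (SIGMA ps:Ps. Cs ps)"
    have inj: "inj_on f (SIGMA ps:Ps. Cs ps)"
    proof (rule inj_onI)
      fix p p' assume p: "p \<in> (SIGMA ps:Ps. Cs ps)" "p' \<in> (SIGMA ps:Ps. Cs ps)" "f p = f p'"
      obtain ps Ss where e: "p = (ps, Ss)" by (rule prod.exhaust)
      obtain ps' Ss' where e': "p' = (ps', Ss')" by (rule prod.exhaust)
      have "length ps = length ps'" using p by (auto simp: e e' Ps_def tuples_def)
      then have *: "ps = ps'" "concat Ss = concat Ss'" using p(3) by (simp_all add: f_def e e')
      have "Ss \<in> Cs ps" "Ss' \<in> Cs ps'" using p(1,2) by (simp_all add: e e')
      then have "Ss \<in> blowups (replicate b (k * b - 1)) V" "Ss' \<in> blowups (replicate b (k * b - 1)) V"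
        using CsB by blast+
      then have "Ss = Ss'" using inj_onD[OF inj_on_concat_blowups *(2)] by simp
      then show "p = p'" using * by (simp add: e e')
    qed
    have mm: "b + b * (k * b - 1) = ?m"
    proof -
      have "b + b * (k * b - 1) = b * Suc (k * b - 1)" by simp
      also have "Suc (k * b - 1) = k * b" using k b by simp
      finally show ?thesis by simp
    qed
    have AT: "A \<subseteq> tuples ?m V"
    proof
      fix zs assume "zs \<in> A"
      then obtain ps Ss where zs: "zs = ps @ concat Ss" "ps \<in> Ps" "Ss \<in> Cs ps" by (auto simp: A_def f_def)
      have "concat Ss \<in> tuples (b * (k * b - 1)) V"
        using zs(3) CsB concat_blowups by (fastforce simp: sum_list_replicate)
      then show "zs \<in> tuples ?m V" using zs(1,2) mm by (auto simp: tuples_def Ps_def)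
    qed
    have "2 * \<xi> * ?n ^ ?m = (d * ?n ^ b) * (c1 * ?n ^ (k * b - 1)) ^ b"
      unfolding \<xi>_def mm[symmetric] by (simp add: power_mult_distrib power_add power_mult[symmetric] mult.commute)
    also have "\<dots> \<le> card Ps * (c1 * ?n ^ (k * b - 1)) ^ b"
      using Ps c1 by (intro mult_right_mono) auto
    also have "\<dots> = (\<Sum>ps\<in>Ps. (c1 * ?n ^ (k * b - 1)) ^ b)" by simp
    also have "\<dots> \<le> (\<Sum>ps\<in>Ps. real (card (Cs ps)))" using Cs by (intro sum_mono) blast
    also have "\<dots> = card (SIGMA ps:Ps. Cs ps)" using finPs Cs by (subst card_SigmaI) auto
    also have "\<dots> = card A" unfolding A_def using inj by (simp add: card_image)
    finally have A: "2 * \<xi> * ?n ^ ?m \<le> card A" .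
    let ?B = "{zs\<in>tuples ?m V. distinct zs \<and> set zs \<inter> F = {}}"
    have "?n ^ ?m - card ?B \<le> \<xi> * ?n ^ ?m"
    proof -
      have "2 * real ?m * real ?m / \<xi> \<le> ?n" using N3 nN by linarith
      then have "real ?m * real ?m \<le> \<xi> / 2 * ?n" using \<xi> by (simp add: field_simps)
      moreover have "real ?m * card F \<le> real ?m * (\<sigma> * ?n)"
        using F(2) by (intro mult_left_mono) auto
      moreover have "real ?m * (\<sigma> * ?n) = \<xi> / 2 * ?n" using m0 by (simp add: \<sigma>_def)
      ultimately have "real ?m * card F + real ?m * real ?m \<le> \<xi> * ?n" by linarith
      then have "real (?m * (card F + ?m)) \<le> \<xi> * ?n"
        by (simp only: of_nat_mult of_nat_add distrib_left)
      then have "real (?m * (card F + ?m)) / ?n \<le> \<xi>" using n by (simp add: divide_le_eq)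
      then have "(1 - \<xi>) * ?n ^ ?m \<le> (1 - real (?m * (card F + ?m)) / ?n) * ?n ^ ?m"
        by (intro mult_right_mono) auto
      also have "\<dots> \<le> card ?B" by (rule card_clean_tuples[OF h(1) F(1)])
      finally show ?thesis by (simp add: algebra_simps)
    qed
    moreover have "card A \<le> card (A \<inter> ?B) + card (tuples ?m V - ?B)"
    proof -
      have "card A \<le> card ((A \<inter> ?B) \<union> (tuples ?m V - ?B))"
        using h(1) AT by (intro card_mono) auto
      also have "\<dots> \<le> card (A \<inter> ?B) + card (tuples ?m V - ?B)" by (rule card_Un_le)
      finally show ?thesis .
    qed
    moreover have "real (card (tuples ?m V - ?B)) = ?n ^ ?m - card ?B"
    proof -
      have "card (tuples ?m V - ?B) = card (tuples ?m V) - card ?B"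
        using h(1) by (intro card_Diff_subset) auto
      moreover have "card ?B \<le> card (tuples ?m V)" using h(1) by (intro card_mono) auto
      ultimately show ?thesis using h(1) by (simp add: of_nat_diff card_tuples)
    qed
    ultimately have "\<xi> * ?n ^ ?m \<le> card (A \<inter> ?B)" using A by linarith
    also have "\<dots> \<le> card {zs\<in>tuples ?m V. set zs \<inter> F = {} \<and> absorbs K E (set zs) Q}"
    proof (intro of_nat_mono card_mono subsetI)
      show "finite {zs\<in>tuples ?m V. set zs \<inter> F = {} \<and> absorbs K E (set zs) Q}" using h(1) by simp
      fix zs assume zsA: "zs \<in> A \<inter> ?B"
      then obtain ps Ss where zs: "zs = ps @ concat Ss" "ps \<in> Ps" "Ss \<in> Cs ps" by (auto simp: A_def f_def)
      have dz: "distinct zs" "set zs \<inter> F = {}" using zsA by auto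
      have lps: "length ps = b" using zs(2) by (simp add: Ps_def tuples_def)
      have lSs: "length Ss = b" and con: "\<And>i. i < b \<Longrightarrow> Ss ! i \<in> ?C (qs ! i) (ps ! i)"
        using zs(3) by (auto simp: Cs_def listset_iff_nth)
      have clq: "tiled (spans K E) X" if "balanced_clique k b E X" for X
        using balanced_clique_tiled_by_copies[OF h(2) _ finK b(1) _ col that] k b by simp
      have "tiled (spans K E) (set ps \<union> set (concat Ss))"
        by (rule tiled_attach)
           (use lps lSs con clq dz zs(1) in \<open>auto simp: connectors_def\<close>)
      moreover have "tiled (spans K E) (set qs \<union> set (concat Ss))"
      proof (rule tiled_attach)
        show "distinct (qs @ concat Ss)" using qs dz zs(1) Q(1) by auto
      qed (use lqs lSs con clq in \<open>auto simp: connectors_def\<close>)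
      moreover have "tiled (spans K E) (set ps)"
        using zs(2) by (intro tiled_single) (simp add: Ps_def)
      moreover have "set ps \<inter> (set qs \<union> set (concat Ss)) = {}"
        using dz zs(1) Q(1) qs(1) by auto
      ultimately have "tiled (spans K E) (set zs)" "tiled (spans K E) (set ps \<union> (set qs \<union> set (concat Ss)))"
        using zs(1) by (simp, intro tiled_Un[of _ "set ps" "set qs \<union> set (concat Ss)"])
      moreover have "set ps \<union> (set qs \<union> set (concat Ss)) = set zs \<union> Q"
        using zs(1) qs(1) by auto
      ultimately have "absorbs K E (set zs) Q" by (simp add: absorbs_def)
      then show "zs \<in> {zs\<in>tuples ?m V. set zs \<inter> F = {} \<and> absorbs K E (set zs) Q}"
        using zsA by auto
    qed
    finally show ?thesis by simp
  qed
  show ?thesis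
    by (rule exI[of _ \<xi>], rule conjI[OF \<xi>], rule exI[of _ \<sigma>], rule conjI[OF \<sigma>],
        rule exI[of _ "Suc (N1 + N2 + N3)"], intro allI impI, rule main)
qed

section \<open>The absorbing set\<close>

text \<open>Many tuples R-related to each Q remain after excluding a small set F. Give Q the weight
  2^(-c), where c is the number of sets chosen so far that are related to Q. By averaging,
  some tuple outside the union of the chosen sets is related to elements of at least the
  proportion \<open>\<xi>\<close> of the total weight; choosing it halves the weight of these
  elements, so the total weight drops by the factor 1 - \<open>\<xi>\<close>/2.\<close>

lemma greedy_disjoint_family:
  fixes \<xi> s :: real and R :: "'v set \<Rightarrow> 'q \<Rightarrow> bool"
  assumes finV: "finite V" "V \<noteq> {}" and finQ: "finite \<Q>" "\<Q> \<noteq> {}" and m: "m > 0"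
    and \<xi>: "0 < \<xi>" 
    and many: "\<And>F Q. F \<subseteq> V \<Longrightarrow> card F \<le> s \<Longrightarrow> Q \<in> \<Q> \<Longrightarrow>
      \<xi> * real (card V) ^ m \<le> card {zs\<in>tuples m V. set zs \<inter> F = {} \<and> R (set zs) Q}"
  shows "real (m * j) \<le> s \<Longrightarrow> \<exists>\<Z>. finite \<Z> \<and> disjoint \<Z> \<and> \<Union>\<Z> \<subseteq> V \<and> card (\<Union>\<Z>) \<le> m * j \<and>
    (\<forall>A\<in>\<Z>. \<exists>Q\<in>\<Q>. R A Q) \<and>
    (\<Sum>Q\<in>\<Q>. (1/2) ^ card {A\<in>\<Z>. R A Q}) \<le> card \<Q> * (1 - \<xi> / 2) ^ j"
proof (induction j)
  case 0
  show ?case by (intro exI[of _ "{}"]) (auto simp: disjoint_def)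
next
  case (Suc j)
  let ?n = "real (card V)"
  have n: "?n > 0" using finV by (simp add: card_gt_0_iff)
  have js: "real (m * j) \<le> s" using Suc.prems by (simp add: algebra_simps)
  from Suc.IH[OF js] obtain \<Z> where Z: "finite \<Z>" "disjoint \<Z>" "\<Union>\<Z> \<subseteq> V" "card (\<Union>\<Z>) \<le> m * j"
    "\<forall>A\<in>\<Z>. \<exists>Q\<in>\<Q>. R A Q"
    and \<Phi>: "(\<Sum>Q\<in>\<Q>. (1/2) ^ card {A\<in>\<Z>. R A Q}) \<le> card \<Q> * (1 - \<xi> / 2) ^ j"
    by (elim exE conjE)
  define w :: "'q \<Rightarrow> real" where "w Q = (1/2) ^ card {A\<in>\<Z>. R A Q}" for Q
  define F where "F = \<Union>\<Z>"
  have "real (card F) \<le> s" using Z(4) js unfolding F_def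
    by (metis of_nat_le_iff of_nat_mult order_trans)
  then have many': "\<xi> * ?n ^ m \<le> card {zs\<in>tuples m V. set zs \<inter> F = {} \<and> R (set zs) Q}" if "Q \<in> \<Q>" for Q
    using many[of F Q] Z(3) that by (simp add: F_def)
  have w0: "w Q > 0" for Q by (simp add: w_def)
  define T where "T = {zs\<in>tuples m V. set zs \<inter> F = {}}"
  have finT: "finite T" using finV by (simp add: T_def)
  have cT: "real (card T) \<le> ?n ^ m"
  proof -
    have "card T \<le> card (tuples m V)" using finV by (intro card_mono) (auto simp: T_def)
    then show ?thesis using finV by (simp add: card_tuples flip: of_nat_power)
  qed
  define gain where "gain zs = (\<Sum>Q\<in>\<Q>. if R (set zs) Q then w Q else 0)" for zs
  have W: "sum w \<Q> > 0" using finQ w0 by (intro sum_pos) auto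
  have "\<exists>zs\<in>T. \<xi> * sum w \<Q> \<le> gain zs"
  proof (rule ccontr)
    assume "\<not> ?thesis"
    then have less: "gain zs < \<xi> * sum w \<Q>" if "zs \<in> T" for zs using that by (simp add: not_le)
    have "sum w \<Q> * (\<xi> * ?n ^ m) = (\<Sum>Q\<in>\<Q>. w Q * (\<xi> * ?n ^ m))" by (simp add: sum_distrib_right)
    also have "\<dots> \<le> (\<Sum>Q\<in>\<Q>. w Q * card {zs\<in>T. R (set zs) Q})"
    proof (intro sum_mono mult_left_mono)
      fix Q assume "Q \<in> \<Q>"
      have "{zs\<in>T. R (set zs) Q} = {zs\<in>tuples m V. set zs \<inter> F = {} \<and> R (set zs) Q}"
        by (auto simp: T_def)
      then show "\<xi> * ?n ^ m \<le> card {zs\<in>T. R (set zs) Q}" using many'[OF \<open>Q \<in> \<Q>\<close>] by simp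
    qed (simp add: w_def)
    also have "\<dots> = (\<Sum>Q\<in>\<Q>. \<Sum>zs\<in>T. if R (set zs) Q then w Q else 0)"
      using finT by (simp add: real_card_filter sum_distrib_left if_distrib cong: if_cong)
    also have "\<dots> = (\<Sum>zs\<in>T. gain zs)" unfolding gain_def by (rule sum.swap)
    finally have *: "sum w \<Q> * (\<xi> * ?n ^ m) \<le> (\<Sum>zs\<in>T. gain zs)" .
    have pos: "sum w \<Q> * (\<xi> * ?n ^ m) > 0" using W \<xi> n by simp
    then have "T \<noteq> {}" using * by auto
    then have "(\<Sum>zs\<in>T. gain zs) < (\<Sum>zs\<in>T. \<xi> * sum w \<Q>)"
      using finT less by (intro sum_strict_mono) auto
    also have "\<dots> = card T * (\<xi> * sum w \<Q>)" by simp
    also have "\<dots> \<le> ?n ^ m * (\<xi> * sum w \<Q>)" using cT \<xi> W by (intro mult_right_mono) auto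
    finally show False using * by (simp add: mult.commute mult.left_commute)
  qed
  then obtain zs where zs: "zs \<in> T" "\<xi> * sum w \<Q> \<le> gain zs" by blast
  have "gain zs > 0" using zs(2) \<xi> W by (meson less_le_trans mult_pos_pos)
  have exQ: "\<exists>Q\<in>\<Q>. R (set zs) Q"
  proof (rule ccontr)
    assume "\<not> ?thesis"
    then have "gain zs = 0" unfolding gain_def by (intro sum.neutral) auto
    then show False using \<open>gain zs > 0\<close> by simp
  qed
  have zsV: "set zs \<subseteq> V" "length zs = m" "set zs \<inter> F = {}" using zs(1) by (auto simp: T_def tuples_def)
  have "set zs \<noteq> {}" using zsV(2) m by auto
  have new: "set zs \<notin> \<Z>"
  proof
    assume "set zs \<in> \<Z>"
    then have "set zs \<subseteq> F" unfolding F_def by (rule Union_upper)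
    then show False using zsV(3) \<open>set zs \<noteq> {}\<close> by (simp add: Int_absorb2)
  qed
  let ?Z = "insert (set zs) \<Z>"
  have cnt: "(1/2 :: real) ^ card {A\<in>?Z. R A Q} = w Q - (if R (set zs) Q then w Q else 0) / 2" for Q
  proof (cases "R (set zs) Q")
    case True
    then have "{A\<in>?Z. R A Q} = insert (set zs) {A\<in>\<Z>. R A Q}" by auto
    then have "card {A\<in>?Z. R A Q} = Suc (card {A\<in>\<Z>. R A Q})" using Z(1) new by simp
    then show ?thesis using True by (simp add: w_def)
  next
    case False
    then have "{A\<in>?Z. R A Q} = {A\<in>\<Z>. R A Q}" by auto
    then show ?thesis using False by (simp add: w_def)
  qed
  show ?case
  proof (rule exI[of _ ?Z], intro conjI)
    show "finite ?Z" using Z by simp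
    show "disjoint ?Z" using Z(2) zsV(3) by (auto simp: disjoint_def F_def)
    show "\<Union>?Z \<subseteq> V" using Z(3) zsV by simp
    have "card (\<Union>?Z) \<le> card (set zs) + card (\<Union>\<Z>)" using card_Un_le[of "set zs" "\<Union>\<Z>"] by simp
    then show "card (\<Union>?Z) \<le> m * Suc j" using Z(4) zsV(2) card_length[of zs] by simp
    show "\<forall>A\<in>?Z. \<exists>Q\<in>\<Q>. R A Q" using Z(5) exQ by simp
    have "(\<Sum>Q\<in>\<Q>. (1/2 :: real) ^ card {A\<in>?Z. R A Q}) = sum w \<Q> - gain zs / 2"
      unfolding cnt gain_def by (simp add: sum_subtractf sum_divide_distrib)
    also have "\<dots> \<le> sum w \<Q> * (1 - \<xi> / 2)" using zs(2) by (simp add: algebra_simps)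
    also have "\<dots> \<le> card \<Q> * (1 - \<xi> / 2) ^ Suc j"
    proof -
      have "\<xi> * ?n ^ m \<le> ?n ^ m"
      proof -
        obtain Q where "Q \<in> \<Q>" using finQ by blast
        have "card {zs\<in>tuples m V. set zs \<inter> F = {} \<and> R (set zs) Q} \<le> card (tuples m V)"
          using finV by (intro card_mono) auto
        then have "real (card {zs\<in>tuples m V. set zs \<inter> F = {} \<and> R (set zs) Q}) \<le> ?n ^ m"
          using finV by (simp add: card_tuples flip: of_nat_power)
        then show ?thesis using many'[OF \<open>Q \<in> \<Q>\<close>] by linarith
      qed
      then have "\<xi> \<le> 1" using n by simp
      then have "sum w \<Q> * (1 - \<xi> / 2) \<le> (card \<Q> * (1 - \<xi> / 2) ^ j) * (1 - \<xi> / 2)"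
        using \<Phi> unfolding w_def by (intro mult_right_mono) auto
      then show ?thesis by (simp only: power_Suc2 mult.assoc)
    qed
    finally show "(\<Sum>Q\<in>\<Q>. (1/2 :: real) ^ card {A\<in>?Z. R A Q}) \<le> card \<Q> * (1 - \<xi> / 2) ^ Suc j" .
  qed
qed

text \<open>Exponential against polynomial growth, with an explicit threshold: 2^r is at least the
  binomial coefficient of r over b+1, hence at least (r/(b+1))^(b+1).\<close>

lemma power_le_power_of_two:
  fixes a x :: real
  assumes r: "a ^ b * real (Suc b) ^ Suc b \<le> r" "Suc b \<le> r" and x: "0 \<le> x" "x \<le> a * real r"
  shows "x ^ b \<le> 2 ^ r"
proof -
  have "x ^ b \<le> (a * r) ^ b" using x by (intro power_mono) auto
  also have "\<dots> = a ^ b * real r ^ b" by (simp add: power_mult_distrib)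
  also have "\<dots> \<le> (real r / Suc b) ^ Suc b"
  proof -
    have "(a ^ b * real r ^ b) * real (Suc b) ^ Suc b = (a ^ b * real (Suc b) ^ Suc b) * real r ^ b"
      by (simp only: ac_simps)
    also have "\<dots> \<le> r * real r ^ b" using r(1) by (intro mult_right_mono) auto
    finally have "(a ^ b * real r ^ b) * real (Suc b) ^ Suc b \<le> real r ^ Suc b" by simp
    moreover have "real (Suc b) ^ Suc b > 0" by (intro zero_less_power) simp
    ultimately show ?thesis by (simp only: power_divide pos_le_divide_eq)
  qed
  also have "\<dots> \<le> real (r choose Suc b)"
    using r(2) binomial_ge_n_over_k_pow_k[of "Suc b" r, where 'a = real] by simp
  also have "\<dots> \<le> real (2 ^ r)" using binomial_le_pow2 by (simp only: of_nat_le_iff)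
  finally show ?thesis by simp
qed

text \<open>Split L into r sets of size b and absorb them one after another. Each absorber is used once,
  so r absorbers for each set suffice.\<close>

lemma absorb_leftover:
  assumes "finite \<Z>" "disjoint \<Z>" "\<forall>A\<in>\<Z>. tiled (spans K E) A"
    and "finite L" "card L = b * r" "L \<inter> \<Union>\<Z> = {}"
    and "\<And>Q. Q \<subseteq> L \<Longrightarrow> card Q = b \<Longrightarrow> r \<le> card {A\<in>\<Z>. absorbs K E A Q}" and b: "b > 0"
  shows "tiled (spans K E) (L \<union> \<Union>\<Z>)"
  using assms(1-7)
proof (induction r arbitrary: \<Z> L)
  case 0
  then have "L = {}" by simp
  have "tiled (spans K E) (\<Union>A\<in>\<Z>. A)"
    using 0 by (intro tiled_UN) (auto simp: disjoint_family_on_def disjoint_def)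
  then show ?case using \<open>L = {}\<close> by simp
next
  case (Suc r)
  have "b \<le> card L" using Suc.prems(5) by simp
  then obtain Q where Q: "Q \<subseteq> L" "card Q = b" by (meson obtain_subset_with_card_n)
  have finQ: "finite Q" using Q Suc.prems(4) finite_subset by blast
  have "Suc r \<le> card {A\<in>\<Z>. absorbs K E A Q}" using Suc.prems(7) Q by blast
  then have "card {A\<in>\<Z>. absorbs K E A Q} \<noteq> 0" by linarith
  then have "{A\<in>\<Z>. absorbs K E A Q} \<noteq> {}" by (metis card.empty)
  then obtain A where A: "A \<in> \<Z>" "absorbs K E A Q" by blast
  have "tiled (spans K E) ((L - Q) \<union> \<Union>(\<Z> - {A}))"
  proof (rule Suc.IH)
    show "finite (\<Z> - {A})" using Suc.prems by simp
    show "disjoint (\<Z> - {A})" using Suc.prems(2) by (auto simp: disjoint_def)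
    show "\<forall>A\<in>\<Z> - {A}. tiled (spans K E) A" using Suc.prems by simp
    show "finite (L - Q)" using Suc.prems by simp
    show "card (L - Q) = b * r" using Suc.prems(5) Q finQ by (simp add: card_Diff_subset)
    show "(L - Q) \<inter> \<Union>(\<Z> - {A}) = {}" using Suc.prems(6) by auto
    fix Q' assume Q': "Q' \<subseteq> L - Q" "card Q' = b"
    then have "Suc r \<le> card {A\<in>\<Z>. absorbs K E A Q'}" using Suc.prems(7)[of Q'] by auto
    also have "\<dots> \<le> card (insert A {A'\<in>\<Z> - {A}. absorbs K E A' Q'})"
      using Suc.prems(1) by (intro card_mono) auto
    also have "\<dots> \<le> Suc (card {A'\<in>\<Z> - {A}. absorbs K E A' Q'})"
      using Suc.prems(1) by (simp add: card_insert_if)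
    finally show "r \<le> card {A'\<in>\<Z> - {A}. absorbs K E A' Q'}" by simp
  qed
  moreover have "tiled (spans K E) (A \<union> Q)" using A(2) by (simp add: absorbs_def)
  moreover have "(A \<union> Q) \<inter> ((L - Q) \<union> \<Union>(\<Z> - {A})) = {}"
  proof -
    have "A \<inter> \<Union>(\<Z> - {A}) = {}" using Suc.prems(2) A(1) by (auto simp: disjoint_def)
    moreover have "A \<inter> L = {}" "Q \<inter> \<Union>\<Z> = {}" using Suc.prems(6) A(1) Q(1) by auto
    ultimately show ?thesis by auto
  qed
  ultimately have "tiled (spans K E) ((A \<union> Q) \<union> ((L - Q) \<union> \<Union>(\<Z> - {A})))"
    by (intro tiled_Un[of _ "A \<union> Q"])
  moreover have "(A \<union> Q) \<union> ((L - Q) \<union> \<Union>(\<Z> - {A})) = L \<union> \<Union>\<Z>" using A(1) Q(1) by auto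
  ultimately show ?case by simp
qed

text \<open>After M r greedy steps the total weight is at most |V|^b \<open>\<rho>\<close>^(M r), where
  M is chosen with \<open>\<rho>\<close>^M at most 1/4 and r is linear in |V|, so that |V|^b
  is at most 2^r. Then every weight is at most 2^(-r), which means that every b-set has r
  absorbers in the family.\<close>

lemma absorbing_set:
  fixes \<alpha> \<beta> :: real and K :: "'a hypergraph"
  assumes k: "k \<ge> 2" and \<alpha>: "\<alpha> > 0" and \<beta>: "\<beta> > 0" and finK: "finite (verts K)"
    and col: "partite_colouring k K c" and ne: "edges K \<noteq> {}"
    and b: "card (verts K) = b" "b \<ge> 2"
  shows "\<exists>\<gamma>>0. \<exists>N. \<forall>(V :: 'v set) E. half_codegree k E \<alpha> V \<longrightarrow> card V \<ge> N \<longrightarrow>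
    (\<exists>A\<subseteq>V. card A \<le> \<beta> * card V \<and> tiled (spans K E) A \<and>
      (\<forall>L\<subseteq>V - A. b dvd card L \<longrightarrow> real (card L) \<le> \<gamma> * real (card V) \<longrightarrow> tiled (spans K E) (L \<union> A)))"
proof -
  let ?m = "k * b * b"
  have m0: "?m > 0" using k b by simp
  obtain \<xi> \<sigma> N1 where \<xi>: "\<xi> > 0" and \<sigma>: "\<sigma> > 0" and N1: "\<forall>(V :: 'v set) E Q F.
    half_codegree k E \<alpha> V \<longrightarrow> card V \<ge> N1 \<longrightarrow>
    Q \<subseteq> F \<longrightarrow> card Q = b \<longrightarrow> F \<subseteq> V \<longrightarrow> real (card F) \<le> \<sigma> * real (card V) \<longrightarrow>
    \<xi> * real (card V) ^ ?m \<le>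
      card {zs\<in>tuples ?m V. set zs \<inter> F = {} \<and> absorbs K E (set zs) Q}"
    using many_absorbers[OF k \<alpha> finK col ne b, where 'v = 'v] by (elim exE conjE)
  \<comment> \<open>the maximum keeps \<rho> nonnegative before \<xi> \<le> 1 is derived from the
    existence of a suitable V\<close>
  define \<rho> where "\<rho> = max 0 (1 - \<xi> / 2)"
  have "\<bar>\<rho>\<bar> < 1" using \<xi> by (auto simp: \<rho>_def)
  then obtain M0 where M0: "\<rho> ^ M0 < 1/4"
    using real_arch_pow_inv[of "1/4" \<rho>] by (auto simp: abs_less_iff)
  define M where "M = Suc M0"
  have M: "\<rho> ^ M \<le> 1/4" "M > 0"
  proof -
    have "\<rho> ^ M \<le> \<rho> ^ M0" using \<open>\<bar>\<rho>\<bar> < 1\<close> unfolding M_def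
      by (intro power_decreasing) (auto simp: \<rho>_def)
    then show "\<rho> ^ M \<le> 1/4" using M0 by simp
  qed (simp add: M_def)
  \<comment> \<open>with r about \<kappa> |V|, the union of M r absorbers of size k b b stays below
    \<beta> |V| and below \<sigma>/2 |V|, half of what may be excluded in the choice of
    an absorber; the other half leaves room for Q\<close>
  define \<kappa> where "\<kappa> = min (\<sigma> / 2) \<beta> / (?m * M)"
  have mM: "real (?m * M) > 0" using m0 M by simp
  have \<kappa>: "\<kappa> > 0" using \<sigma> \<beta> mM unfolding \<kappa>_def by (intro divide_pos_pos) auto
  \<comment> \<open>a bound for |V| / r\<close>
  define a where "a = 2 / \<kappa>"
  obtain N2 :: nat where N2: "(a ^ b * real (Suc b) ^ Suc b + real (Suc b) + 1) / (\<kappa> / 2) \<le> N2"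
    using real_arch_simple by blast
  obtain N3 :: nat where N3: "2 * real b / \<sigma> \<le> N3" using real_arch_simple by blast
  define \<gamma> where "\<gamma> = \<kappa> / 2"
  have main: "\<exists>A\<subseteq>V. card A \<le> \<beta> * card V \<and> tiled (spans K E) A \<and>
      (\<forall>L\<subseteq>V - A. b dvd card L \<longrightarrow> real (card L) \<le> \<gamma> * real (card V) \<longrightarrow> tiled (spans K E) (L \<union> A))"
    if hc: "half_codegree k E \<alpha> V" and nN: "N1 + N2 + N3 + b + 1 \<le> card V"
    for V :: "'v set" and E
  proof -
    note h = half_codegreeD[OF hc]
    let ?n = "real (card V)"
    have n: "?n > 0" using nN by linarith
    then have Vne: "V \<noteq> {}" by auto
    define r where "r = nat \<lfloor>\<kappa> * ?n\<rfloor>"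
    have r: "real r \<le> \<kappa> * ?n" "\<kappa> * ?n < real r + 1"
      using \<kappa> n by (auto simp: r_def)
    have "(a ^ b * real (Suc b) ^ Suc b + real (Suc b) + 1) / (\<kappa> / 2) \<le> ?n" using N2 nN by linarith
    then have "a ^ b * real (Suc b) ^ Suc b + real (Suc b) + 1 \<le> \<kappa> / 2 * ?n"
      using \<kappa> by (simp add: pos_divide_le_eq mult.commute)
    moreover have a0: "a ^ b * real (Suc b) ^ Suc b \<ge> 0" using \<kappa> by (simp add: a_def)
    ultimately have r1: "a ^ b * real (Suc b) ^ Suc b \<le> r" "Suc b \<le> r" and \<gamma>r: "\<gamma> * ?n \<le> r"
      using r by (simp_all add: \<gamma>_def)
    have "?n = a * (\<kappa> / 2 * ?n)" using \<kappa> by (simp add: a_def)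
    also have "\<dots> \<le> a * r" using \<gamma>r \<kappa> by (intro mult_left_mono) (auto simp: \<gamma>_def a_def)
    finally have nb: "?n ^ b \<le> 2 ^ r" using r1 n by (intro power_le_power_of_two[of a]) auto
    define \<Q> where "\<Q> = {Q. Q \<subseteq> V \<and> card Q = b}"
    have finQ: "finite \<Q>" using h(1) by (simp add: \<Q>_def)
    have cQ: "card \<Q> \<le> ?n ^ b"
    proof -
      have "card \<Q> = card V choose b" unfolding \<Q>_def by (rule n_subsets[OF h(1)])
      also have "\<dots> \<le> card V ^ b" using nN by (intro binomial_le_pow) simp
      finally show ?thesis by (simp flip: of_nat_power)
    qed
    have "\<exists>Q. Q \<subseteq> V \<and> card Q = b"
      using nN by (metis add_leD1 add_leD2 obtain_subset_with_card_n)
    then have Qne: "\<Q> \<noteq> {}" by (auto simp: \<Q>_def)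
    have s1: "real (?m * (M * r)) \<le> min (\<sigma> / 2) \<beta> * ?n"
    proof -
      have "real (?m * (M * r)) = real (?m * M) * r" by simp
      also have "\<dots> \<le> real (?m * M) * (\<kappa> * ?n)" using r by (intro mult_left_mono) auto
      also have "\<dots> = real (?m * M) * \<kappa> * ?n" by simp
      also have "real (?m * M) * \<kappa> = min (\<sigma> / 2) \<beta>"
        unfolding \<kappa>_def by (rule nonzero_mult_div_cancel_left[OF less_imp_neq[OF mM, symmetric], folded times_divide_eq_right])
      finally show ?thesis .
    qed
    have b\<sigma>: "b \<le> \<sigma> / 2 * ?n"
    proof -
      have "2 * real b / \<sigma> \<le> ?n" using N3 nN by linarith
      then show ?thesis using \<sigma> by (simp add: field_simps)
    qed
    have many: "\<xi> * ?n ^ ?m \<le> card {zs\<in>tuples ?m V. set zs \<inter> F = {} \<and> absorbs K E (set zs) Q}"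
      if F: "F \<subseteq> V" "real (card F) \<le> \<sigma> / 2 * ?n" and Q: "Q \<in> \<Q>" for F Q
    proof -
      have "card (F \<union> Q) \<le> card F + card Q" by (rule card_Un_le)
      then have "real (card (F \<union> Q)) \<le> \<sigma> * ?n" using F b\<sigma> Q by (simp add: \<Q>_def)
      then have "\<xi> * ?n ^ ?m \<le> card {zs\<in>tuples ?m V. set zs \<inter> (F \<union> Q) = {} \<and> absorbs K E (set zs) Q}"
        using F Q nN by (intro N1[rule_format, OF hc]) (auto simp: \<Q>_def)
      also have "\<dots> \<le> card {zs\<in>tuples ?m V. set zs \<inter> F = {} \<and> absorbs K E (set zs) Q}"
        using h(1) by (intro of_nat_mono card_mono) auto
      finally show ?thesis by simp
    qed
    have "\<exists>\<Z>. finite \<Z> \<and> disjoint \<Z> \<and> \<Union>\<Z> \<subseteq> V \<and> card (\<Union>\<Z>) \<le> ?m * (M * r) \<and>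
      (\<forall>A\<in>\<Z>. \<exists>Q\<in>\<Q>. absorbs K E A Q) \<and>
      (\<Sum>Q\<in>\<Q>. (1/2) ^ card {A\<in>\<Z>. absorbs K E A Q}) \<le> card \<Q> * (1 - \<xi> / 2) ^ (M * r)"
    proof (rule greedy_disjoint_family[OF h(1) Vne finQ Qne m0 \<xi>])
      show "\<xi> * ?n ^ ?m \<le> card {zs\<in>tuples ?m V. set zs \<inter> F = {} \<and> absorbs K E (set zs) Q}"
        if "F \<subseteq> V" "real (card F) \<le> \<sigma> / 2 * ?n" "Q \<in> \<Q>" for F Q
        by (rule many[OF that])
      show "real (?m * (M * r)) \<le> \<sigma> / 2 * ?n"
        using s1 n by (meson min.cobounded1 mult_right_mono less_imp_le order_trans)
    qed
    then obtain \<Z> where Z: "finite \<Z>" "disjoint \<Z>" "\<Union>\<Z> \<subseteq> V" "card (\<Union>\<Z>) \<le> ?m * (M * r)"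
      "\<forall>A\<in>\<Z>. \<exists>Q\<in>\<Q>. absorbs K E A Q"
      and \<Phi>: "(\<Sum>Q\<in>\<Q>. (1/2 :: real) ^ card {A\<in>\<Z>. absorbs K E A Q}) \<le> card \<Q> * (1 - \<xi> / 2) ^ (M * r)"
      by (elim exE conjE)
    have cnt: "r \<le> card {A\<in>\<Z>. absorbs K E A Q}" if Q: "Q \<in> \<Q>" for Q
    proof -
      have "\<xi> * ?n ^ ?m \<le> card (tuples ?m V)"
      proof -
        have "\<xi> * ?n ^ ?m \<le> card {zs\<in>tuples ?m V. set zs \<inter> {} = {} \<and> absorbs K E (set zs) Q}"
          using \<sigma> n by (intro many Q) auto
        also have "\<dots> \<le> card (tuples ?m V)" using h(1) by (intro of_nat_mono card_mono) auto
        finally show ?thesis by simp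
      qed
      then have "\<xi> \<le> 1" using h(1) n by (simp add: card_tuples)
      then have \<rho>: "1 - \<xi> / 2 = \<rho>" by (simp add: \<rho>_def)
      have "(1/2 :: real) ^ card {A\<in>\<Z>. absorbs K E A Q}
        \<le> (\<Sum>Q\<in>\<Q>. (1/2 :: real) ^ card {A\<in>\<Z>. absorbs K E A Q})"
        using finQ Q by (intro member_le_sum) auto
      also have "\<dots> \<le> ?n ^ b * \<rho> ^ (M * r)"
      proof -
        have "card \<Q> * \<rho> ^ (M * r) \<le> ?n ^ b * \<rho> ^ (M * r)"
          using cQ by (intro mult_right_mono) (auto simp: \<rho>_def)
        then show ?thesis using \<Phi> unfolding \<rho> by linarith
      qed
      also have "\<dots> \<le> 2 ^ r * (1/4) ^ r"
      proof (rule mult_mono[OF nb])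
        show "\<rho> ^ (M * r) \<le> (1/4) ^ r" unfolding power_mult
          using M by (intro power_mono) (auto simp: \<rho>_def)
      qed (auto simp: \<rho>_def)
      also have "\<dots> = (1/2 :: real) ^ r" by (simp flip: power_mult_distrib)
      finally show ?thesis by (simp add: power_decreasing_iff)
    qed
    have tZ: "\<forall>A\<in>\<Z>. tiled (spans K E) A" using Z(5) by (auto simp: absorbs_def)
    show ?thesis
    proof (intro exI[of _ "\<Union>\<Z>"] conjI allI impI)
      show "\<Union>\<Z> \<subseteq> V" by fact
      show "real (card (\<Union>\<Z>)) \<le> \<beta> * ?n"
      proof -
        have "real (card (\<Union>\<Z>)) \<le> real (?m * (M * r))" using Z(4) by (simp only: of_nat_le_iff)
        also have "\<dots> \<le> min (\<sigma> / 2) \<beta> * ?n" by (rule s1)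
        also have "\<dots> \<le> \<beta> * ?n" using n by (intro mult_right_mono) auto
        finally show ?thesis .
      qed
      show "tiled (spans K E) (\<Union>\<Z>)"
        using absorb_leftover[OF Z(1,2) tZ, of "{}" b 0] b by simp
      fix L assume L: "L \<subseteq> V - \<Union>\<Z>" "b dvd card L" "real (card L) \<le> \<gamma> * ?n"
      have finL: "finite L" using L(1) h(1) by (meson Diff_subset finite_subset)
      obtain r' where r': "card L = b * r'" using L(2) by (elim dvdE)
      have "r' \<le> b * r'" using b by simp
      moreover have "real (b * r') \<le> r" using L(3) \<gamma>r unfolding r' by linarith
      ultimately have "r' \<le> r" by linarith
      show "tiled (spans K E) (L \<union> \<Union>\<Z>)"
      proof (rule absorb_leftover[OF Z(1,2) tZ finL r'])
        show "L \<inter> \<Union>\<Z> = {}" using L(1) by auto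
        fix Q assume "Q \<subseteq> L" "card Q = b"
        then have "Q \<in> \<Q>" using L(1) by (auto simp: \<Q>_def)
        then show "r' \<le> card {A\<in>\<Z>. absorbs K E A Q}" using cnt \<open>r' \<le> r\<close> order_trans by blast
      qed (use b in simp)
    qed
  qed
  have \<gamma>: "\<gamma> > 0" using \<kappa> by (simp add: \<gamma>_def)
  show ?thesis
    by (rule exI[of _ \<gamma>], rule conjI[OF \<gamma>],
        rule exI[of _ "N1 + N2 + N3 + b + 1"], intro allI impI, rule main)
qed

section \<open>Perfect packings\<close>

lemma packing_of_tiled:
  assumes "tiled (spans K (edges G)) X" "X \<subseteq> verts G"
  shows "\<exists>P. packing K G P \<and> (\<Union>H\<in>P. verts H) = X"
  using assms
proof induction
  case tiled_empty
  show ?case by (intro exI[of _ "{}"]) (simp add: packing_def)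
next
  case (tiled_insert A X)
  obtain P where P: "packing K G P" "(\<Union>H\<in>P. verts H) = X"
    using tiled_insert by auto
  obtain \<phi> where \<phi>: "inj_on \<phi> (verts K)" "\<phi> ` verts K = A" "\<forall>e\<in>edges K. \<phi> ` e \<in> edges G"
    using tiled_insert(1) unfolding spans_def by blast
  define H where "H = \<lparr>verts = A, edges = (\<lambda>e. \<phi> ` e) ` edges K\<rparr>"
  have "hypergraph_iso K H"
    unfolding hypergraph_iso_def H_def using \<phi> by (auto simp: bij_betw_def intro!: exI[of _ \<phi>])
  moreover have "subhypergraph H G"
    unfolding subhypergraph_def H_def using \<phi>(3) tiled_insert.prems by auto
  ultimately have "is_copy K G H" by (simp add: is_copy_def)
  moreover have "disjnt (verts H) (verts H')" "disjnt (verts H') (verts H)" if "H' \<in> P" for H'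
  proof -
    have "verts H' \<subseteq> X" using P(2) that by blast
    then show "disjnt (verts H) (verts H')" "disjnt (verts H') (verts H)"
      using tiled_insert(2) by (auto simp: disjnt_def H_def)
  qed
  ultimately have "packing K G (insert H P)"
    using P(1) unfolding packing_def by (simp add: pairwise_insert)
  moreover have "(\<Union>H\<in>insert H P. verts H) = A \<union> X" using P(2) by (simp add: H_def)
  ultimately show ?case by blast
qed

text \<open>An edge containing a (k-1)-set S is S with one further vertex, so the codegree of S counts
  these vertices.\<close>

lemma half_codegree_of_min_codegree:
  assumes G: "kgraph k G" and k: "k \<ge> 1"
    and deg: "real (min_codegree k G) \<ge> (1/2 + \<alpha>) * card (verts G)"
  shows "half_codegree k (edges G) \<alpha> (verts G)"
  unfolding half_codegree_def
proof (intro conjI allI impI)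
  show fin: "finite (verts G)" and "\<forall>e\<in>edges G. card e = k"
    using G by (simp_all add: kgraph_def)
  fix S assume S: "S \<subseteq> verts G" "card S = k - 1"
  have finS: "finite S" using S(1) fin finite_subset by blast
  have "min_codegree k G \<le> codegree G S"
    unfolding min_codegree_def using fin S by (intro Min_le) auto
  also have "codegree G S \<le> card ((\<lambda>v. insert v S) ` {v\<in>verts G. insert v S \<in> edges G})"
    unfolding codegree_def
  proof (intro card_mono subsetI)
    show "finite ((\<lambda>v. insert v S) ` {v\<in>verts G. insert v S \<in> edges G})" using fin by simp
    fix e assume e: "e \<in> {e \<in> edges G. S \<subseteq> e}"
    then have e': "e \<subseteq> verts G" "card e = k" using G by (auto simp: kgraph_def)
    then have "finite e" using fin finite_subset by blast
    then have "card (e - S) = 1" using e e' S finS k by (simp add: card_Diff_subset)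
    then obtain v where "e - S = {v}" by (rule card_1_singletonE)
    then have "e = insert v S" "v \<in> verts G" using e e' by auto
    then show "e \<in> (\<lambda>v. insert v S) ` {v\<in>verts G. insert v S \<in> edges G}" using e by auto
  qed
  also have "\<dots> \<le> card {v\<in>verts G. insert v S \<in> edges G}"
    using fin by (intro card_image_le) simp
  finally show "(1/2 + \<alpha>) * card (verts G) \<le> card {v\<in>verts G. insert v S \<in> edges G}"
    using deg by linarith
qed

lemma half_codegree_Diff:
  assumes hc: "half_codegree k E \<alpha> V" and A: "A \<subseteq> V" "real (card A) \<le> \<alpha> / 2 * card V" and \<alpha>: "\<alpha> \<ge> 0"
  shows "half_codegree k E (\<alpha> / 2) (V - A)"
  unfolding half_codegree_def
proof (intro conjI allI impI)
  note h = half_codegreeD[OF hc]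
  show "finite (V - A)" "\<forall>e\<in>E. card e = k" using h by simp_all
  fix S assume S: "S \<subseteq> V - A" "card S = k - 1"
  have finA: "finite A" using A h(1) finite_subset by blast
  have "(1/2 + \<alpha>) * card V \<le> card {v\<in>V. insert v S \<in> E}" using S by (intro h(3)) auto
  also have "card {v\<in>V. insert v S \<in> E} \<le> card ({v\<in>V - A. insert v S \<in> E} \<union> A)"
    using h(1) finA by (intro card_mono) auto
  also have "\<dots> \<le> card {v\<in>V - A. insert v S \<in> E} + card A" by (rule card_Un_le)
  finally have "(1/2 + \<alpha>) * card V \<le> real (card {v\<in>V - A. insert v S \<in> E}) + card A" by simp
  then have "(1/2 + \<alpha> / 2) * card V \<le> card {v\<in>V - A. insert v S \<in> E}"
    using A(2) by (simp add: algebra_simps)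
  moreover have "(1/2 + \<alpha> / 2) * card (V - A) \<le> (1/2 + \<alpha> / 2) * card V"
    using h(1) \<alpha> by (intro mult_left_mono) (auto intro: card_mono)
  ultimately show "(1/2 + \<alpha> / 2) * card (V - A) \<le> card {v\<in>V - A. insert v S \<in> E}" by linarith
qed

text \<open>The absorbing set A has at most \<open>\<alpha>/2\<close> |V| vertices, which preserves the
  codegree condition with \<open>\<alpha>/2\<close> on V - A, and at most half of all
  vertices, so that V - A is still large. The leftover of an almost perfect tiling of V - A
  has size divisible by b, since V and all tiled sets do.\<close>

lemma perfect_tiling:
  fixes \<alpha> :: real and K :: "'a hypergraph"
  assumes k: "k \<ge> 3" and \<alpha>: "\<alpha> > 0" and finK: "finite (verts K)"
    and col: "partite_colouring k K c" and ne: "edges K \<noteq> {}"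
    and b: "card (verts K) = b" "b \<ge> 2"
  shows "\<exists>N. \<forall>(V :: 'v set) E. half_codegree k E \<alpha> V \<longrightarrow> card V \<ge> N \<longrightarrow> b dvd card V \<longrightarrow>
    tiled (spans K E) V"
proof -
  have k2: "k \<ge> 2" and b0: "b > 0" using k b by simp_all
  define \<beta> where "\<beta> = min (\<alpha> / 2) (1/2)"
  have \<beta>: "\<beta> > 0" using \<alpha> by (simp add: \<beta>_def)
  obtain \<gamma> N1 where \<gamma>: "\<gamma> > 0" and N1: "\<forall>(V :: 'v set) E. half_codegree k E \<alpha> V \<longrightarrow> card V \<ge> N1 \<longrightarrow>
    (\<exists>A\<subseteq>V. card A \<le> \<beta> * card V \<and> tiled (spans K E) A \<and>
      (\<forall>L\<subseteq>V - A. b dvd card L \<longrightarrow> real (card L) \<le> \<gamma> * real (card V) \<longrightarrow> tiled (spans K E) (L \<union> A)))"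
    using absorbing_set[OF k2 \<alpha> \<beta> finK col ne b, where 'v = 'v] by (elim exE conjE)
  have \<alpha>2: "\<alpha> / 2 > 0" using \<alpha> by simp
  obtain N2 where N2: "\<forall>(V :: 'v set) E. half_codegree k E (\<alpha> / 2) V \<longrightarrow> card V \<ge> N2 \<longrightarrow>
     (\<exists>X\<subseteq>V. tiled (balanced_clique k b E) X \<and> (1 - \<gamma>) * card V \<le> card X)"
    using almost_perfect_tiling[OF k \<alpha>2 \<gamma> b0, where 'v = 'v] by (elim exE)
  have "tiled (spans K E) V"
    if hc: "half_codegree k E \<alpha> V" and nN: "N1 + 2 * N2 \<le> card V" and dvd: "b dvd card V"
    for V :: "'v set" and E
  proof -
    note h = half_codegreeD[OF hc]
    let ?n = "real (card V)"
    obtain A where A: "A \<subseteq> V" "card A \<le> \<beta> * ?n" "tiled (spans K E) A" and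
      absorb: "\<forall>L\<subseteq>V - A. b dvd card L \<longrightarrow> real (card L) \<le> \<gamma> * ?n \<longrightarrow> tiled (spans K E) (L \<union> A)"
      using N1[rule_format, OF hc] nN by auto
    define V' where "V' = V - A"
    have finA: "finite A" using A(1) h(1) finite_subset by blast
    have cV': "card V = card V' + card A"
      using A(1) h(1) finA by (simp add: V'_def card_Diff_subset card_mono)
    have "\<beta> * ?n \<le> \<alpha> / 2 * ?n" "\<beta> * ?n \<le> 1/2 * ?n"
      by (intro mult_right_mono; simp add: \<beta>_def)+
    then have "real (card A) \<le> \<alpha> / 2 * ?n" "real (card A) \<le> 1/2 * ?n" using A(2) by linarith+
    then have hc': "half_codegree k E (\<alpha> / 2) V'" and "N2 \<le> card V'"
      using half_codegree_Diff[OF hc A(1)] \<alpha> nN cV' by (simp_all add: V'_def)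
    then obtain X where X: "X \<subseteq> V'" "tiled (balanced_clique k b E) X" "(1 - \<gamma>) * card V' \<le> card X"
      using N2[rule_format, OF hc'] by auto
    have finX: "finite X" using X(1) h(1) by (simp add: V'_def finite_subset)
    have tX: "tiled (spans K E) X"
      using tiled_trans[OF X(2)] balanced_clique_tiled_by_copies[OF h(2) _ finK b(1) b0 col] k by simp
    define L where "L = V' - X"
    have cL: "card V' = card L + card X"
      using X(1) h(1) finX by (simp add: L_def V'_def card_Diff_subset card_mono)
    have "b dvd card A" "b dvd card X"
      using tiled_card[OF A(3)] tiled_card[OF tX] spans_card[OF finK] b(1) by blast+
    moreover have "card V = card L + (card X + card A)" using cV' cL by simp
    ultimately have "b dvd card L" using dvd by (metis dvd_add dvd_add_left_iff)
    moreover have "real (card L) \<le> \<gamma> * ?n"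
    proof -
      have "real (card L) \<le> \<gamma> * card V'" using X(3) cL by (simp add: algebra_simps)
      also have "\<dots> \<le> \<gamma> * ?n" using \<gamma> cV' by (intro mult_left_mono) auto
      finally show ?thesis .
    qed
    moreover have "L \<subseteq> V - A" by (auto simp: L_def V'_def)
    ultimately have "tiled (spans K E) (L \<union> A)" using absorb by simp
    moreover have "X \<inter> (L \<union> A) = {}" using X(1) by (auto simp: L_def V'_def)
    ultimately have "tiled (spans K E) (X \<union> (L \<union> A))" using tX by (intro tiled_Un[of _ X])
    moreover have "X \<union> (L \<union> A) = V" using X(1) A(1) by (auto simp: L_def V'_def)
    ultimately show ?thesis by simp
  qed
  then show ?thesis by (intro exI[of _ "N1 + 2 * N2"] allI impI)
qed

theorem theorem1p1:
  fixes K :: "'a hypergraph" and k b :: nat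
  assumes "k \<ge> 3"
    and "kgraph k K"
    and "kpartite k K"
    and "card (verts K) = b"
  shows "\<forall>\<alpha>::real. \<alpha> > 0 \<longrightarrow>
    (\<exists>n\<^sub>0::nat. \<forall>(G :: 'v hypergraph) (n::nat).
      kgraph k G \<longrightarrow> card (verts G) = n \<longrightarrow> n \<ge> n\<^sub>0 \<longrightarrow> b dvd n \<longrightarrow>
      real (min_codegree k G) \<ge> real n / 2 + \<alpha> * real n \<longrightarrow>
      (\<exists>P. perfect_packing K G P))"
proof (intro allI impI)
  fix \<alpha> :: real assume \<alpha>: "\<alpha> > 0"
  obtain c where col: "partite_colouring k K c"
    using kpartite_colouring[OF assms(2,3)] .
  have finK: "finite (verts K)" using assms(2) by (simp add: kgraph_def)
  have ne: "edges K \<noteq> {}" using assms(3) by (simp add: kpartite_def)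
  have b2: "b \<ge> 2"
  proof -
    obtain e where "e \<in> edges K" using ne by blast
    then have "e \<subseteq> verts K" "card e = k" using assms(2) by (auto simp: kgraph_def)
    then have "k \<le> b" using card_mono[OF finK] assms(4) by blast
    then show ?thesis using assms(1) by simp
  qed
  obtain N where N: "\<forall>(V :: 'v set) E. half_codegree k E \<alpha> V \<longrightarrow> card V \<ge> N \<longrightarrow> b dvd card V \<longrightarrow>
    tiled (spans K E) V"
    using perfect_tiling[OF assms(1) \<alpha> finK col ne assms(4) b2, where 'v = 'v] by (elim exE)
  show "\<exists>n\<^sub>0::nat. \<forall>(G :: 'v hypergraph) (n::nat).
      kgraph k G \<longrightarrow> card (verts G) = n \<longrightarrow> n \<ge> n\<^sub>0 \<longrightarrow> b dvd n \<longrightarrow>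
      real (min_codegree k G) \<ge> real n / 2 + \<alpha> * real n \<longrightarrow>
      (\<exists>P. perfect_packing K G P)"
  proof (intro exI[of _ N] allI impI)
    fix G :: "'v hypergraph" and n
    assume G: "kgraph k G" "card (verts G) = n" "N \<le> n" "b dvd n"
      and deg: "real n / 2 + \<alpha> * real n \<le> real (min_codegree k G)"
    have "half_codegree k (edges G) \<alpha> (verts G)"
      using assms(1) deg G(2) by (intro half_codegree_of_min_codegree[OF G(1)]) (simp_all add: algebra_simps)
    then have "tiled (spans K (edges G)) (verts G)" using N G by simp
    then show "\<exists>P. perfect_packing K G P"
      unfolding perfect_packing_def by (rule packing_of_tiled) simp
  qed
qed

end
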